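(* Let $a<b$, $\alpha,\beta\in(0,1)$, $l\in\mathbb{R}$, and let $L,g:[a,b]\times\mathbb{R}^3\to\mathbb{R}$, $(x,y,u,v)\mapsto L(x,y,u,v)$, $(x,y,u,v)\mapsto g(x,y,u,v)$, have continuous first and second partial derivatives with respect to all their arguments. Put $$\mathcal{J}(y)=\int_a^b L\big(x,y(x),{_a\mathcal{D}_x^\alpha}y(x),{_x\mathcal{D}_b^\beta}y(x)\big)\,dx,\qquad \mathcal{I}(y)=\int_a^b g\big(x,y(x),{_a\mathcal{D}_x^\alpha}y(x),{_x\mathcal{D}_b^\beta}y(x)\big)\,dx$$ for admissible functions $y$. Suppose that the admissible function $y$ is a local minimizer or a local maximizer of $\mathcal{J}$ subject to the boundary conditions $y(a)=y_a$, $y(b)=y_b$ and the isoperimetric constraint $\mathcal{I}(y)=l$, and that $L$, $g$ satisfy along $y$ the regularity conditions listed in the context. Then there exist two constants $\lambda_0,\lambda\in\mathbb{R}$, not both zero, such that, with $K=\lambda_0L-\lambda g$, $$\frac{\partial K}{\partial y}+{_x\mathcal{D}_b^\alpha}\frac{\partial K}{\partial u}+{_a\mathcal{D}_x^\beta}\frac{\partial K}{\partial v}=0\quad\text{for all }x\in[a,b],$$ where the partial derivatives of $K$ are evaluated at $\big(x,y(x),{_a\mathcal{D}_x^\alpha}y(x),{_x\mathcal{D}_b^\beta}y(x)\big)$.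
   Context: For $\gamma\in(0,1)$, real numbers $c<d$ and a continuous function $f$, the left and right Riemann-Liouville fractional derivatives are $${_c\mathcal{D}_x^\gamma}f(x)=\frac{1}{\Gamma(1-\gamma)}\frac{d}{dx}\int_c^x (x-t)^{-\gamma}f(t)\,dt\quad (x>c),\qquad {_x\mathcal{D}_d^\gamma}f(x)=\frac{-1}{\Gamma(1-\gamma)}\frac{d}{dx}\int_x^d (t-x)^{-\gamma}f(t)\,dt\quad (x<d).$$ Saying that such a derivative is continuous on a closed interval means that it exists and extends continuously to the endpoint where the formula is not defined; values at that endpoint are the limits. Admissible functions: continuous $y:[a,b]\to\mathbb{R}$ such that ${_a\mathcal{D}_x^\alpha}y$ and ${_x\mathcal{D}_b^\beta}y$ are continuous on $[a,b]$. Each of these two requirements is imposed only if the corresponding derivative is present in the problem (i.e. $L$ or $g$ depends on $u$, respectively on $v$); if a derivative is not present, the corresponding argument is simply omitted. The prescribed boundary values satisfy $y_a=0$ if left fractional derivatives are present and $y_b=0$ if right fractional derivatives are present. Regularity conditions along $y$: the functions $x\mapsto\frac{\partial L}{\partial u}$ and $x\mapsto\frac{\partial g}{\partial u}$, evaluated at $(x,y(x),{_a\mathcal{D}_x^\alpha}y(x),{_x\mathcal{D}_b^\beta}y(x))$, have continuous right fractional derivative ${_x\mathcal{D}_b^\alpha}$ on $[a,b]$, and $x\mapsto\frac{\partial L}{\partial v}$, $x\mapsto\frac{\partial g}{\partial v}$, evaluated at the same point, have continuous left fractional derivative ${_a\mathcal{D}_x^\beta}$ on $[a,b]$. Local extremum: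 fix a norm $\|\cdot\|$ on the linear space of admissible functions. $y$ is a local minimizer (resp. maximizer) of $\mathcal{J}$ subject to the boundary conditions and the constraint if $y$ is admissible and satisfies them, and there is $\delta>0$ such that $\mathcal{J}(y)\le\mathcal{J}(y_1)$ (resp. $\mathcal{J}(y)\ge\mathcal{J}(y_1)$) for all admissible $y_1$ satisfying the same boundary conditions and constraint with $\|y-y_1\|<\delta$. *)

theory Defs
  imports "HOL-Analysis.Analysis"
begin

text \<open>
  Functions on \<open>[c, d]\<close> are represented by total functions whose values outside \<open>[c, d]\<close> are
  irrelevant.  All derivatives are therefore taken within the domain, that is, they are one-sided
  at the endpoints.
\<close>

definition left_RL_int :: "real \<Rightarrow> real \<Rightarrow> (real \<Rightarrow> real) \<Rightarrow> real \<Rightarrow> real" where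
  "left_RL_int \<gamma> c f x = integral {c..x} (\<lambda>t. (x - t) powr (- \<gamma>) * f t)"

definition right_RL_int :: "real \<Rightarrow> real \<Rightarrow> (real \<Rightarrow> real) \<Rightarrow> real \<Rightarrow> real" where
  "right_RL_int \<gamma> d f x = integral {x..d} (\<lambda>t. (t - x) powr (- \<gamma>) * f t)"

definition left_RL_formula :: "real \<Rightarrow> real \<Rightarrow> real \<Rightarrow> (real \<Rightarrow> real) \<Rightarrow> real \<Rightarrow> real" where
  "left_RL_formula \<gamma> c d f x =
     1 / Gamma (1 - \<gamma>) * vector_derivative (left_RL_int \<gamma> c f) (at x within {c..d})"

definition right_RL_formula :: "real \<Rightarrow> real \<Rightarrow> real \<Rightarrow> (real \<Rightarrow> real) \<Rightarrow> real \<Rightarrow> real" where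
  "right_RL_formula \<gamma> c d f x =
     (- 1) / Gamma (1 - \<gamma>) * vector_derivative (right_RL_int \<gamma> d f) (at x within {c..d})"

definition left_RL :: "real \<Rightarrow> real \<Rightarrow> real \<Rightarrow> (real \<Rightarrow> real) \<Rightarrow> real \<Rightarrow> real" where
  "left_RL \<gamma> c d f x =
     (if x = c then Lim (at_right c) (left_RL_formula \<gamma> c d f) else left_RL_formula \<gamma> c d f x)"

definition right_RL :: "real \<Rightarrow> real \<Rightarrow> real \<Rightarrow> (real \<Rightarrow> real) \<Rightarrow> real \<Rightarrow> real" where
  "right_RL \<gamma> c d f x =
     (if x = d then Lim (at_left d) (right_RL_formula \<gamma> c d f) else right_RL_formula \<gamma> c d f x)"

text \<open>
  Since the value at the endpoint where the formula does not apply is the limit there, continuity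
  on the closed interval says precisely that the derivative extends continuously to that endpoint.
\<close>

definition has_continuous_left_RL :: "real \<Rightarrow> real \<Rightarrow> real \<Rightarrow> (real \<Rightarrow> real) \<Rightarrow> bool" where
  "has_continuous_left_RL \<gamma> c d f \<longleftrightarrow>
     (\<forall>x\<in>{c<..d}. left_RL_int \<gamma> c f differentiable (at x within {c..d})) \<and>
     continuous_on {c..d} (left_RL \<gamma> c d f)"

definition has_continuous_right_RL :: "real \<Rightarrow> real \<Rightarrow> real \<Rightarrow> (real \<Rightarrow> real) \<Rightarrow> bool" where
  "has_continuous_right_RL \<gamma> c d f \<longleftrightarrow>
     (\<forall>x\<in>{c..<d}. right_RL_int \<gamma> d f differentiable (at x within {c..d})) \<and>
     continuous_on {c..d} (right_RL \<gamma> c d f)"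

type_synonym lagrangian = "real \<times> real \<times> real \<times> real \<Rightarrow> real"

definition partial_within ::
    "'a::euclidean_space set \<Rightarrow> 'a \<Rightarrow> ('a \<Rightarrow> real) \<Rightarrow> 'a \<Rightarrow> real" where
  "partial_within S e F z =
     vector_derivative (\<lambda>t. F (z + t *\<^sub>R e)) (at 0 within {t. z + t *\<^sub>R e \<in> S})"

definition has_continuous_partials ::
    "'a::euclidean_space set \<Rightarrow> ('a \<Rightarrow> real) \<Rightarrow> bool" where
  "has_continuous_partials S F \<longleftrightarrow>
     (\<forall>e\<in>Basis.
        (\<forall>z\<in>S. (\<lambda>t. F (z + t *\<^sub>R e)) differentiable (at 0 within {t. z + t *\<^sub>R e \<in> S})) \<and>
        continuous_on S (partial_within S e F))"

definition has_continuous_partials2 ::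
    "'a::euclidean_space set \<Rightarrow> ('a \<Rightarrow> real) \<Rightarrow> bool" where
  "has_continuous_partials2 S F \<longleftrightarrow>
     has_continuous_partials S F \<and>
     (\<forall>e\<in>Basis. has_continuous_partials S (partial_within S e F))"

definition lag_dom :: "real \<Rightarrow> real \<Rightarrow> (real \<times> real \<times> real \<times> real) set" where
  "lag_dom a b = {a..b} \<times> UNIV"

definition partial_y :: "real \<Rightarrow> real \<Rightarrow> lagrangian \<Rightarrow> lagrangian" where
  "partial_y a b F = partial_within (lag_dom a b) (0, 1, 0, 0) F"

definition partial_u :: "real \<Rightarrow> real \<Rightarrow> lagrangian \<Rightarrow> lagrangian" where
  "partial_u a b F = partial_within (lag_dom a b) (0, 0, 1, 0) F"

definition partial_v :: "real \<Rightarrow> real \<Rightarrow> lagrangian \<Rightarrow> lagrangian" where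
  "partial_v a b F = partial_within (lag_dom a b) (0, 0, 0, 1) F"

definition depends_on_u :: "real \<Rightarrow> real \<Rightarrow> lagrangian \<Rightarrow> bool" where
  "depends_on_u a b F \<longleftrightarrow> (\<exists>x\<in>{a..b}. \<exists>y u u' v. F (x, y, u, v) \<noteq> F (x, y, u', v))"

definition depends_on_v :: "real \<Rightarrow> real \<Rightarrow> lagrangian \<Rightarrow> bool" where
  "depends_on_v a b F \<longleftrightarrow> (\<exists>x\<in>{a..b}. \<exists>y u v v'. F (x, y, u, v) \<noteq> F (x, y, u, v'))"

definition left_present :: "real \<Rightarrow> real \<Rightarrow> lagrangian \<Rightarrow> lagrangian \<Rightarrow> bool" where
  "left_present a b L g \<longleftrightarrow> depends_on_u a b L \<or> depends_on_u a b g"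

definition right_present :: "real \<Rightarrow> real \<Rightarrow> lagrangian \<Rightarrow> lagrangian \<Rightarrow> bool" where
  "right_present a b L g \<longleftrightarrow> depends_on_v a b L \<or> depends_on_v a b g"

definition admissible ::
    "real \<Rightarrow> real \<Rightarrow> real \<Rightarrow> real \<Rightarrow> lagrangian \<Rightarrow> lagrangian \<Rightarrow> (real \<Rightarrow> real) set" where
  "admissible \<alpha> \<beta> a b L g =
     {y. continuous_on {a..b} y \<and>
         (left_present a b L g \<longrightarrow> has_continuous_left_RL \<alpha> a b y) \<and>
         (right_present a b L g \<longrightarrow> has_continuous_right_RL \<beta> a b y)}"

text \<open>
  If a fractional derivative is not present, then the corresponding component below may be
  meaningless, but it is only ever passed to functions that do not depend on it.
\<close>

definition along ::
    "real \<Rightarrow> real \<Rightarrow> real \<Rightarrow> real \<Rightarrow> (real \<Rightarrow> real) \<Rightarrow> real \<Rightarrow> real \<times> real \<times> real \<times> real" where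
  "along \<alpha> \<beta> a b y x = (x, y x, left_RL \<alpha> a b y x, right_RL \<beta> a b y x)"

definition action ::
    "real \<Rightarrow> real \<Rightarrow> real \<Rightarrow> real \<Rightarrow> lagrangian \<Rightarrow> (real \<Rightarrow> real) \<Rightarrow> real" where
  "action \<alpha> \<beta> a b F y = integral {a..b} (\<lambda>x. F (along \<alpha> \<beta> a b y x))"

definition regular_along ::
    "real \<Rightarrow> real \<Rightarrow> real \<Rightarrow> real \<Rightarrow> lagrangian \<Rightarrow> (real \<Rightarrow> real) \<Rightarrow> bool" where
  "regular_along \<alpha> \<beta> a b F y \<longleftrightarrow>
     has_continuous_right_RL \<alpha> a b (\<lambda>x. partial_u a b F (along \<alpha> \<beta> a b y x)) \<and>
     has_continuous_left_RL \<beta> a b (\<lambda>x. partial_v a b F (along \<alpha> \<beta> a b y x))"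

definition feasible ::
    "real \<Rightarrow> real \<Rightarrow> real \<Rightarrow> real \<Rightarrow> lagrangian \<Rightarrow> lagrangian \<Rightarrow> real \<Rightarrow> real \<Rightarrow> real
      \<Rightarrow> (real \<Rightarrow> real) set" where
  "feasible \<alpha> \<beta> a b L g y\<^sub>a y\<^sub>b l =
     {y \<in> admissible \<alpha> \<beta> a b L g. y a = y\<^sub>a \<and> y b = y\<^sub>b \<and> action \<alpha> \<beta> a b g y = l}"

text \<open>
  Definiteness refers to \<open>[a, b]\<close> only; together with the triangle inequality this forces \<open>N\<close> to
  agree on functions that coincide on \<open>[a, b]\<close>, so \<open>N\<close> is a norm on a space of functions on
  \<open>[a, b]\<close>.
\<close>

definition is_norm_on :: "real \<Rightarrow> real \<Rightarrow> (real \<Rightarrow> real) set \<Rightarrow> ((real \<Rightarrow> real) \<Rightarrow> real) \<Rightarrow> bool" where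
  "is_norm_on a b V N \<longleftrightarrow>
     (\<forall>f\<in>V. 0 \<le> N f) \<and>
     (\<forall>f\<in>V. N f = 0 \<longleftrightarrow> (\<forall>x\<in>{a..b}. f x = 0)) \<and>
     (\<forall>f\<in>V. \<forall>c. N (\<lambda>x. c * f x) = \<bar>c\<bar> * N f) \<and>
     (\<forall>f\<in>V. \<forall>h\<in>V. N (\<lambda>x. f x + h x) \<le> N f + N h)"

definition local_minimizer ::
    "((real \<Rightarrow> real) \<Rightarrow> real) \<Rightarrow> (real \<Rightarrow> real) set \<Rightarrow> ((real \<Rightarrow> real) \<Rightarrow> real) \<Rightarrow> (real \<Rightarrow> real) \<Rightarrow> bool"
  where
  "local_minimizer N X J y \<longleftrightarrow>
     y \<in> X \<and> (\<exists>\<delta>>0. \<forall>y\<^sub>1\<in>X. N (\<lambda>x. y x - y\<^sub>1 x) < \<delta> \<longrightarrow> J y \<le> J y\<^sub>1)"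

definition local_maximizer ::
    "((real \<Rightarrow> real) \<Rightarrow> real) \<Rightarrow> (real \<Rightarrow> real) set \<Rightarrow> ((real \<Rightarrow> real) \<Rightarrow> real) \<Rightarrow> (real \<Rightarrow> real) \<Rightarrow> bool"
  where
  "local_maximizer N X J y \<longleftrightarrow>
     y \<in> X \<and> (\<exists>\<delta>>0. \<forall>y\<^sub>1\<in>X. N (\<lambda>x. y x - y\<^sub>1 x) < \<delta> \<longrightarrow> J y \<ge> J y\<^sub>1)"

end

theory Submission
  imports Defs
begin

text \<open>
  Perturb \<open>y\<close> by \<open>e\<^sub>1 \<eta>\<^sub>1 + e\<^sub>2 \<eta>\<^sub>2\<close>, where the \<open>\<eta>\<^sub>i\<close> are continuously differentiable with compact
  support in the open interval, and consider the values of the two functionals as a map of the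
  plane \<open>(e\<^sub>1, e\<^sub>2)\<close> to the plane.  If its derivative at \<open>0\<close> were invertible, the map would be open
  at \<open>0\<close>, so the objective could be increased and decreased while the constraint is kept; hence the
  Jacobian determinant vanishes for every pair of test functions.  Fractional integration by parts
  writes the first variations as integrals of \<open>\<eta>\<^sub>i\<close> against the Euler-Lagrange expressions of \<open>L\<close>
  and \<open>g\<close>, and the fundamental lemma of the calculus of variations shows that these are linearly
  dependent.
\<close>

section \<open>Fractional integrals\<close>

text \<open>The norm is arbitrary and need not control either functional, so a neighbourhood of
  \<open>y\<close> in the function space gives nothing by itself. On a plane of perturbations,
  however, the triangle inequality turns small coefficients into a small norm. Two parameters are
  the fewest that let the objective move while the constraint is restored. The openness theorem used
  asks for continuity and for differentiability at a single point.

  Compact support of the test functions does three jobs: it preserves the boundary values; it turns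
  the fractional derivative of \<eta> into a fractional integral of its derivative, which is
  continuous up to both endpoints, so that perturbations stay admissible; and it keeps integration
  by parts away from the endpoint where a fractional derivative is only a limit.

  Working with vanishing determinants also covers the abnormal case in which the first variation of
  the constraint is zero; there the multiplier of \<open>L\<close> is taken to be 0.\<close>

definition RL_kernel :: "real \<Rightarrow> real \<Rightarrow> real \<Rightarrow> real" where
  "RL_kernel \<gamma> C s = indicator {0..C} s * s powr (- \<gamma>)"

lemma integrable_RL_kernel:
  assumes "\<gamma> < 1" "0 \<le> C"
  shows "integrable lborel (RL_kernel \<gamma> C)"
proof -
  have "(\<lambda>s. s powr (- \<gamma>)) integrable_on {0..C}"
    using has_integral_powr_from_0[of "- \<gamma>" C] assms by (auto simp: integrable_on_def)
  then have "(\<lambda>s. s powr (- \<gamma>)) absolutely_integrable_on {0..C}"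
    by (intro nonnegative_absolutely_integrable_1) auto
  then have "integrable lebesgue (\<lambda>s. indicator {0..C} s *\<^sub>R s powr (- \<gamma>))"
    by (simp add: set_integrable_def)
  \<comment> \<open>The Henstock-Kurzweil route gives integrability for the completed measure; Borel
    measurability brings it down to \<open>lborel\<close>, where Fubini will be applied.\<close>
  moreover have "(\<lambda>s. indicator {0..C} s *\<^sub>R s powr (- \<gamma>)) \<in> borel_measurable lborel"
    by measurable
  ultimately show ?thesis
    unfolding RL_kernel_def[abs_def] by (simp add: integrable_completion)
qed

lemma measurable_RL_kernel [measurable]: "RL_kernel \<gamma> C \<in> borel_measurable borel"
  unfolding RL_kernel_def[abs_def] by measurable

lemma bounded_indicator_continuous:
  fixes q :: "real \<Rightarrow> real"
  assumes "continuous_on {a..b} q"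
  obtains M where "0 \<le> M" "\<And>x. \<bar>indicator {a..b} x * q x\<bar> \<le> M"
proof -
  have "bounded (q ` {a..b})"
    by (intro compact_imp_bounded compact_continuous_image assms) auto
  then obtain M where M: "\<forall>x\<in>{a..b}. \<bar>q x\<bar> \<le> M"
    by (auto simp: bounded_iff)
  show ?thesis
    by (rule that[of "max M 0"]) (use M in \<open>force simp: indicator_def\<close>)+
qed

lemma integrable_mult_bounded:
  fixes f h :: "real \<Rightarrow> real"
  assumes "integrable lborel f" "h \<in> borel_measurable borel" "\<And>x. \<bar>h x\<bar> \<le> M"
  shows "integrable lborel (\<lambda>x. f x * h x)"
proof (rule Bochner_Integration.integrable_bound)
  show "integrable lborel (\<lambda>x. M * f x)"
    using assms(1) by simp
  show "(\<lambda>x. f x * h x) \<in> borel_measurable lborel"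
    using assms(1,2) by measurable
  have "\<bar>f x\<bar> * \<bar>h x\<bar> \<le> \<bar>M\<bar> * \<bar>f x\<bar>" for x
    using mult_left_mono[OF assms(3), of "\<bar>f x\<bar>" x] mult_right_mono[OF abs_ge_self, of "\<bar>f x\<bar>" M]
    by (simp add: mult.commute)
  then show "AE x in lborel. norm (f x * h x) \<le> norm (M * f x)"
    by (simp add: abs_mult)
qed

context
  fixes \<gamma> a b :: real and q :: "real \<Rightarrow> real"
  assumes gamma: "\<gamma> < 1" and ab: "a \<le> b" and q: "continuous_on {a..b} q"
begin

lemma indicator_mult_measurable: "(\<lambda>t. indicator {a..b} t * q t) \<in> borel_measurable borel"
  using borel_measurable_continuous_on_indicator[of "{a..b}" q] q by simp

lemma integrable_left_RL_kernel:
  "integrable lborel (\<lambda>t. RL_kernel \<gamma> (b - a) (x - t) * (indicator {a..b} t * q t))"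
proof -
  obtain M where M: "\<And>x. \<bar>indicator {a..b} x * q x\<bar> \<le> M"
    using bounded_indicator_continuous[OF q] by metis
  have "integrable lborel (\<lambda>t. RL_kernel \<gamma> (b - a) (x - t))"
    using lborel_integrable_real_affine[OF integrable_RL_kernel, of \<gamma> "b - a" "-1" x] gamma ab by simp
  then show ?thesis
    by (rule integrable_mult_bounded[OF _ indicator_mult_measurable M])
qed

lemma integrable_right_RL_kernel:
  "integrable lborel (\<lambda>t. RL_kernel \<gamma> (b - a) (t - x) * (indicator {a..b} t * q t))"
proof -
  obtain M where M: "\<And>x. \<bar>indicator {a..b} x * q x\<bar> \<le> M"
    using bounded_indicator_continuous[OF q] by metis
  have "integrable lborel (\<lambda>t. RL_kernel \<gamma> (b - a) (t - x))"
    using lborel_integrable_real_affine[OF integrable_RL_kernel, of \<gamma> "b - a" 1 "- x"] gamma ab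
    by (simp add: algebra_simps)
  then show ?thesis
    by (rule integrable_mult_bounded[OF _ indicator_mult_measurable M])
qed

text \<open>The variable limit is absorbed into the cut-off of the kernel: with \<open>t\<close> and
  \<open>x\<close> both in \<open>{a..b}\<close> the upper bound \<open>b - a\<close> is automatic,
  and the lower bound 0 says exactly \<open>t \<le> x\<close>. Thus the fractional integral becomes
  a convolution on the whole line, and the same kernel with reversed argument serves the right
  integral.\<close>

lemma left_RL_int_lborel:
  assumes "x \<in> {a..b}"
  shows "(\<lambda>t. (x - t) powr (- \<gamma>) * q t) integrable_on {a..x}"
    and "left_RL_int \<gamma> a q x = (LINT t|lborel. RL_kernel \<gamma> (b - a) (x - t) * (indicator {a..b} t * q t))"
proof -
  have eq: "(\<lambda>t. RL_kernel \<gamma> (b - a) (x - t) * (indicator {a..b} t * q t))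
      = (\<lambda>t. indicator {a..x} t *\<^sub>R ((x - t) powr (- \<gamma>) * q t))"
    using assms by (auto simp: RL_kernel_def indicator_def fun_eq_iff)
  have si: "set_integrable lborel {a..x} (\<lambda>t. (x - t) powr (- \<gamma>) * q t)"
    using integrable_left_RL_kernel[of x] unfolding eq set_integrable_def .
  from set_borel_integral_eq_integral[OF si]
  show "(\<lambda>t. (x - t) powr (- \<gamma>) * q t) integrable_on {a..x}"
    and "left_RL_int \<gamma> a q x = (LINT t|lborel. RL_kernel \<gamma> (b - a) (x - t) * (indicator {a..b} t * q t))"
    by (simp_all add: left_RL_int_def eq set_lebesgue_integral_def)
qed

lemma right_RL_int_lborel:
  assumes "x \<in> {a..b}"
  shows "(\<lambda>t. (t - x) powr (- \<gamma>) * q t) integrable_on {x..b}"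
    and "right_RL_int \<gamma> b q x = (LINT t|lborel. RL_kernel \<gamma> (b - a) (t - x) * (indicator {a..b} t * q t))"
proof -
  have eq: "(\<lambda>t. RL_kernel \<gamma> (b - a) (t - x) * (indicator {a..b} t * q t))
      = (\<lambda>t. indicator {x..b} t *\<^sub>R ((t - x) powr (- \<gamma>) * q t))"
    using assms by (auto simp: RL_kernel_def indicator_def fun_eq_iff)
  have si: "set_integrable lborel {x..b} (\<lambda>t. (t - x) powr (- \<gamma>) * q t)"
    using integrable_right_RL_kernel[of x] unfolding eq set_integrable_def .
  from set_borel_integral_eq_integral[OF si]
  show "(\<lambda>t. (t - x) powr (- \<gamma>) * q t) integrable_on {x..b}"
    and "right_RL_int \<gamma> b q x = (LINT t|lborel. RL_kernel \<gamma> (b - a) (t - x) * (indicator {a..b} t * q t))"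
    by (simp_all add: right_RL_int_def eq set_lebesgue_integral_def)
qed

end

text \<open>Both sides are iterated integrals of the same function
  \<open>p x * k (x - t) * q t\<close>, with the order of integration exchanged. Fubini applies
  because translation invariance bounds the inner integral of the absolute value by a constant
  multiple of \<open>\<bar>p x\<bar>\<close>, uniformly in the position of the singularity.\<close>

lemma RL_int_adjoint:
  assumes "\<gamma> < 1" "a \<le> b" and p: "continuous_on {a..b} p" and q: "continuous_on {a..b} q"
  shows "(\<lambda>x. p x * left_RL_int \<gamma> a q x) integrable_on {a..b}"
    and "(\<lambda>t. q t * right_RL_int \<gamma> b p t) integrable_on {a..b}"
    and "integral {a..b} (\<lambda>x. p x * left_RL_int \<gamma> a q x) =
         integral {a..b} (\<lambda>t. q t * right_RL_int \<gamma> b p t)"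
proof -
  let ?k = "RL_kernel \<gamma> (b - a)"
  let ?p = "\<lambda>x. indicator {a..b} x * p x" and ?q = "\<lambda>x. indicator {a..b} x * q x"
  let ?h = "\<lambda>x t. ?p x * (?k (x - t) * ?q t)"
  have k: "integrable lborel ?k"
    using integrable_RL_kernel assms by simp
  have pm [measurable]: "?p \<in> borel_measurable borel" and qm [measurable]: "?q \<in> borel_measurable borel"
    using indicator_mult_measurable assms by blast+
  obtain B where B: "0 \<le> B" "\<And>x. \<bar>?q x\<bar> \<le> B"
    using bounded_indicator_continuous[OF q] by metis
  let ?I = "LINT s|lborel. \<bar>?k s\<bar>"
  have hm: "(\<lambda>(x, t). ?h x t) \<in> borel_measurable (lborel \<Otimes>\<^sub>M lborel)"
    unfolding split_beta by measurable
  have kq: "integrable lborel (\<lambda>t. ?k (x - t) * ?q t)" for x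
    using integrable_left_RL_kernel assms by blast
  have kx: "integrable lborel (\<lambda>t. ?k (x - t))" for x
    using lborel_integrable_real_affine[OF k, of "-1" x] by simp
  have shift: "(LINT t|lborel. \<bar>?k (x - t)\<bar>) = ?I" for x
    using lborel_integral_real_affine[of "-1" "\<lambda>s. \<bar>?k s\<bar>" x] by simp
  have bound: "(LINT t|lborel. \<bar>?h x t\<bar>) \<le> \<bar>?p x\<bar> * (B * ?I)" for x
  proof -
    have "(LINT t|lborel. \<bar>?h x t\<bar>) \<le> (LINT t|lborel. \<bar>?p x\<bar> * (B * \<bar>?k (x - t)\<bar>))"
    proof (rule integral_mono)
      show "integrable lborel (\<lambda>t. \<bar>?h x t\<bar>)"
        using kq by (intro integrable_abs integrable_mult_right)
      show "integrable lborel (\<lambda>t. \<bar>?p x\<bar> * (B * \<bar>?k (x - t)\<bar>))"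
        using kx by (intro integrable_abs integrable_mult_right)
      fix t
      have "\<bar>?k (x - t)\<bar> * \<bar>?q t\<bar> \<le> B * \<bar>?k (x - t)\<bar>"
        using mult_left_mono[OF B(2), of "\<bar>?k (x - t)\<bar>" t] by (simp add: mult.commute)
      then show "\<bar>?h x t\<bar> \<le> \<bar>?p x\<bar> * (B * \<bar>?k (x - t)\<bar>)"
        unfolding abs_mult[of "?p x"] abs_mult[of "?k (x - t)"] by (intro mult_left_mono) auto
    qed
    then show ?thesis
      by (simp add: shift)
  qed
  have "integrable lborel ?p"
    using borel_integrable_atLeastAtMost'[OF p] by (simp add: set_integrable_def)
  then have p0: "integrable lborel (\<lambda>x. ?p x * (B * ?I))"
    by (rule integrable_mult_left)
  have I_nonneg: "0 \<le> ?I"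
    by (intro Bochner_Integration.integral_nonneg) simp
  have int1: "integrable lborel (\<lambda>x. LINT t|lborel. \<bar>?h x t\<bar>)"
  proof (rule Bochner_Integration.integrable_bound[OF p0])
    show "(\<lambda>x. LINT t|lborel. \<bar>?h x t\<bar>) \<in> borel_measurable lborel"
      using hm by (intro lborel.borel_measurable_lebesgue_integral) (auto simp: split_beta)
    have "norm (LINT t|lborel. \<bar>?h x t\<bar>) \<le> norm (?p x * (B * ?I))" for x
    proof -
      have "0 \<le> (LINT t|lborel. \<bar>?h x t\<bar>)"
        by (intro Bochner_Integration.integral_nonneg) simp
      then have "norm (LINT t|lborel. \<bar>?h x t\<bar>) \<le> \<bar>?p x\<bar> * (B * ?I)"
        using bound[of x] unfolding real_norm_def by linarith
      also have "\<bar>?p x\<bar> * (B * ?I) = norm (?p x * (B * ?I))"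
        using I_nonneg \<open>0 \<le> B\<close> unfolding real_norm_def abs_mult by (simp only: abs_of_nonneg)
      finally show ?thesis .
    qed
    then show "AE x in lborel. norm (LINT t|lborel. \<bar>?h x t\<bar>) \<le> norm (?p x * (B * ?I))"
      by (rule AE_I2)
  qed
  have hint: "integrable (lborel \<Otimes>\<^sub>M lborel) (\<lambda>(x, t). ?h x t)"
  proof (rule lborel_pair.Fubini_integrable[OF hm])
    show "integrable lborel (\<lambda>x. LINT t|lborel. norm (case (x, t) of (x, t) \<Rightarrow> ?h x t))"
      using int1 by simp
    show "AE x in lborel. integrable lborel (\<lambda>t. case (x, t) of (x, t) \<Rightarrow> ?h x t)"
      using kq by (auto intro!: AE_I2 integrable_mult_right)
  qed
  have e1: "(\<lambda>x. LINT t|lborel. ?h x t) = (\<lambda>x. indicator {a..b} x *\<^sub>R (p x * left_RL_int \<gamma> a q x))"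
    using left_RL_int_lborel(2)[OF assms(1,2) q]
    by (auto simp: fun_eq_iff indicator_def)
  have e2: "(\<lambda>t. LINT x|lborel. ?h x t) = (\<lambda>t. indicator {a..b} t *\<^sub>R (q t * right_RL_int \<gamma> b p t))"
  proof
    fix t
    have "(LINT x|lborel. ?h x t) = (LINT x|lborel. ?q t * (?k (x - t) * ?p x))"
      by (intro Bochner_Integration.integral_cong) auto
    also have "\<dots> = ?q t * (LINT x|lborel. ?k (x - t) * ?p x)"
      by simp
    also have "\<dots> = indicator {a..b} t *\<^sub>R (q t * right_RL_int \<gamma> b p t)"
      using right_RL_int_lborel(2)[OF assms(1,2) p, of t] by (auto simp: indicator_def)
    finally show "(LINT x|lborel. ?h x t) = indicator {a..b} t *\<^sub>R (q t * right_RL_int \<gamma> b p t)" .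
  qed
  have s1: "set_integrable lborel {a..b} (\<lambda>x. p x * left_RL_int \<gamma> a q x)"
    using lborel_pair.integrable_fst[OF hint] unfolding e1 set_integrable_def .
  have s2: "set_integrable lborel {a..b} (\<lambda>t. q t * right_RL_int \<gamma> b p t)"
    using lborel_pair.integrable_snd[OF hint] unfolding e2 set_integrable_def .
  show "(\<lambda>x. p x * left_RL_int \<gamma> a q x) integrable_on {a..b}"
    and "(\<lambda>t. q t * right_RL_int \<gamma> b p t) integrable_on {a..b}"
    using set_borel_integral_eq_integral(1) s1 s2 by blast+
  have "(LINT x|lborel. LINT t|lborel. ?h x t) = (LINT t|lborel. LINT x|lborel. ?h x t)"
    using lborel_pair.Fubini_integral[OF hint] by simp
  then show "integral {a..b} (\<lambda>x. p x * left_RL_int \<gamma> a q x) =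
         integral {a..b} (\<lambda>t. q t * right_RL_int \<gamma> b p t)"
    unfolding e1 e2 set_lebesgue_integral_def[symmetric]
    using set_borel_integral_eq_integral(2)[OF s1] set_borel_integral_eq_integral(2)[OF s2] by simp
qed

section \<open>Test functions\<close>

text \<open>
  Substituting \<open>t = x - r powr (1 / (1 - \<gamma>))\<close> absorbs the singular kernel, so that the integral over a
  fixed interval can be differentiated under the integral sign.
\<close>

lemma left_RL_int_desingularized:
  assumes gamma: "0 < \<gamma>" "\<gamma> < 1" and f: "continuous_on UNIV f" and f0: "\<And>t. t \<le> c \<Longrightarrow> f t = 0"
    and cd: "c < d" and x: "x \<in> {c..d}"
  shows "left_RL_int \<gamma> c f x =
    integral {0..(d - c) powr (1 - \<gamma>)} (\<lambda>r. 1 / (1 - \<gamma>) * f (x - r powr (1 / (1 - \<gamma>))))"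
proof -
  define m where "m = 1 / (1 - \<gamma>)"
  \<comment> \<open>Chosen so that \<open>R powr m = d - c\<close>: the substitution then maps
    \<open>S\<close> onto an interval ending at \<open>x\<close> whose length does not depend on
    \<open>x\<close>. The part of it to the left of \<open>c\<close> contributes nothing, because
    \<open>f\<close> vanishes there.\<close>
  define R where "R = (d - c) powr (1 - \<gamma>)"
  define S where "S = {0<..<R}"
  define g where "g r = x - r powr m" for r
  define g' where "g' r = - (m * r powr (m - 1))" for r
  define F where "F t = (x - t) powr (- \<gamma>) * f t" for t
  have m: "0 < m" "m * (1 - \<gamma>) = 1" using gamma by (auto simp: m_def)
  then have m': "m - 1 - m * \<gamma> = 0" by (simp add: algebra_simps)
  have Rm: "R powr m = d - c" and "0 < R"
    using cd gamma by (auto simp: R_def m_def powr_powr)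
  have root: "(r powr m) powr (1 - \<gamma>) = r" if "r \<in> S" for r
    using that m by (simp add: S_def powr_powr)
  have inj: "inj_on g S"
    by (rule inj_on_inverseI[where g = "\<lambda>t. (x - t) powr (1 - \<gamma>)"]) (simp add: g_def root)
  have der: "(g has_field_derivative g' r) (at r within S)" if "r \<in> S" for r
    unfolding g_def g'_def using that
    by (auto simp: S_def intro!: derivative_eq_intros)
  have img: "g ` S = {x - (d - c)<..<x}"
  proof (intro equalityI subsetI)
    fix t assume "t \<in> g ` S"
    then obtain r where r: "0 < r" "r < R" "t = x - r powr m" by (auto simp: g_def S_def)
    have "r powr m < R powr m" using r m by (intro powr_less_mono2) auto
    then show "t \<in> {x - (d - c)<..<x}" using r Rm by auto
  next
    fix t assume t: "t \<in> {x - (d - c)<..<x}"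
    define r where "r = (x - t) powr (1 - \<gamma>)"
    have "r powr m = x - t" "0 < r" using t m by (auto simp: r_def powr_powr mult.commute)
    moreover have "r < R"
      unfolding r_def R_def using t gamma by (intro powr_less_mono2) auto
    ultimately show "t \<in> g ` S" by (intro image_eqI[of _ _ r]) (auto simp: g_def S_def)
  qed
  \<comment> \<open>The Jacobian contributes the exponent \<open>m - 1\<close> and the kernel
    \<open>- m * \<gamma>\<close>; \<open>m\<close> is the value for which they cancel.\<close>
  have eq: "\<bar>g' r\<bar> * F (g r) = m * f (x - r powr m)" if "r \<in> S" for r
  proof -
    have "0 < r" using that by (simp add: S_def)
    then have "r powr (m - 1) * (r powr m) powr (- \<gamma>) = 1"
      by (simp add: powr_powr powr_add[symmetric] m')
    then have "m * (r powr (m - 1) * (r powr m) powr (- \<gamma>)) * f (x - r powr m) = m * f (x - r powr m)"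
      by simp
    then show ?thesis
      using m by (simp add: g'_def F_def g_def abs_mult mult.assoc)
  qed
  have powr_cont: "continuous_on {0..R} (\<lambda>r. r powr m)"
    using m by (intro continuous_on_powr' continuous_on_id continuous_on_const) auto
  have cont: "continuous_on {0..R} (\<lambda>r. m * f (x - r powr m))"
    using powr_cont
    by (intro continuous_on_mult_left continuous_on_compose2[OF f] continuous_on_diff continuous_on_const) auto
  then have "(\<lambda>r. m * f (x - r powr m)) absolutely_integrable_on S"
    unfolding S_def by (intro set_integrable_subset[OF absolutely_integrable_continuous_real]) auto
  then have ai: "(\<lambda>r. \<bar>g' r\<bar> * F (g r)) absolutely_integrable_on S"
    by (subst set_integrable_cong[OF refl refl eq])
  have "F absolutely_integrable_on (g ` S) \<and>
    integral (g ` S) F = integral S (\<lambda>r. \<bar>g' r\<bar> * F (g r))"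
    using has_absolute_integral_change_of_variables_1'[THEN iffD1, OF _ der inj] ai
    by (auto simp: S_def)
  then have F: "F absolutely_integrable_on {x - (d - c)<..<x}"
    and I: "integral {x - (d - c)<..<x} F = integral S (\<lambda>r. m * f (x - r powr m))"
    using eq unfolding img by (auto cong: integral_cong)
  have Fi: "F integrable_on {x - (d - c)..x}"
    using F set_lebesgue_integral_eq_integral(1) by (auto simp: integrable_on_Icc_iff_Ioo)
  have "integral {x - (d - c)..c} F = integral {x - (d - c)..c} (\<lambda>_. 0)"
    by (rule integral_cong) (auto simp: F_def f0)
  moreover have "integral {x - (d - c)..c} F + integral {c..x} F = integral {x - (d - c)..x} F"
    using x Fi by (intro Henstock_Kurzweil_Integration.integral_combine) auto
  ultimately have "integral {c..x} F = integral {x - (d - c)..x} F" by simp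
  also have "\<dots> = integral {0..R} (\<lambda>r. m * f (x - r powr m))"
    by (simp add: integral_open_interval_real I S_def)
  finally show ?thesis by (simp add: left_RL_int_def F_def[abs_def] R_def m_def)
qed

text \<open>The derivative is carried as a second argument so that it can be used as a function
  without a choice operator. The pair is globally defined and vanishes outside a compact part of the
  open interval; in particular it is 0 to the left of \<open>a\<close>, which the desingularizing
  substitution needs because it reaches beyond the interval.\<close>

definition test_function :: "real \<Rightarrow> real \<Rightarrow> (real \<Rightarrow> real) \<Rightarrow> (real \<Rightarrow> real) \<Rightarrow> bool" where
  "test_function a b \<eta> \<eta>' \<longleftrightarrow>
     (\<forall>t. (\<eta> has_real_derivative \<eta>' t) (at t)) \<and> continuous_on UNIV \<eta>' \<and>
     (\<exists>c d. a < c \<and> c < d \<and> d < b \<and> (\<forall>t. t \<notin> {c..d} \<longrightarrow> \<eta> t = 0 \<and> \<eta>' t = 0))"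

lemma test_function_continuous: "test_function a b \<eta> \<eta>' \<Longrightarrow> continuous_on S \<eta>"
  unfolding test_function_def by (meson DERIV_continuous continuous_at_imp_continuous_on)

lemma test_function_reflect:
  assumes "test_function a b \<eta> \<eta>'"
  shows "test_function (- b) (- a) (\<lambda>t. \<eta> (- t)) (\<lambda>t. - \<eta>' (- t))"
proof -
  obtain c d where cd: "a < c" "c < d" "d < b" "\<forall>t. t \<notin> {c..d} \<longrightarrow> \<eta> t = 0 \<and> \<eta>' t = 0"
    and der: "\<And>t. (\<eta> has_real_derivative \<eta>' t) (at t)" and cont: "continuous_on UNIV \<eta>'"
    using assms unfolding test_function_def by auto
  have "((\<lambda>t. \<eta> (- t)) has_real_derivative - \<eta>' (- t)) (at t)" for t
  proof -
    have "(uminus has_real_derivative - 1) (at t)" by (auto intro!: derivative_eq_intros)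
    from DERIV_chain2[OF der this] show ?thesis by simp
  qed
  moreover have "continuous_on UNIV (\<lambda>t. - \<eta>' (- t))"
    by (intro continuous_intros continuous_on_compose2[OF cont]) auto
  moreover have "- b < - d \<and> - d < - c \<and> - c < - a \<and>
     (\<forall>t. t \<notin> {- d..- c} \<longrightarrow> \<eta> (- t) = 0 \<and> - \<eta>' (- t) = 0)"
    using cd(1-3) cd(4)[rule_format, of "- t" for t] by (auto simp: not_le)
  ultimately show ?thesis
    unfolding test_function_def by blast
qed

text \<open>In the desingularized form \<open>x\<close> occurs only in the argument of \<eta>, so
  differentiation under the integral sign puts the derivative on \<eta>; no boundary term arises, as
  \<eta> vanishes near \<open>a\<close>. The formula holds at both endpoints, one-sidedly.\<close>

lemma left_RL_int_test_function:
  assumes gamma: "0 < \<gamma>" "\<gamma> < 1" and test: "test_function a b \<eta> \<eta>'" and ab: "a < b"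
  shows "continuous_on {a..b} (left_RL_int \<gamma> a \<eta>')"
    and "x \<in> {a..b} \<Longrightarrow>
      (left_RL_int \<gamma> a \<eta> has_real_derivative left_RL_int \<gamma> a \<eta>' x) (at x within {a..b})"
proof -
  define R where "R = (b - a) powr (1 - \<gamma>)"
  let ?m = "1 / (1 - \<gamma>)"
  obtain c d where "a < c" and zero: "\<forall>t. t \<notin> {c..d} \<longrightarrow> \<eta> t = 0 \<and> \<eta>' t = 0"
    and der: "\<And>t. (\<eta> has_real_derivative \<eta>' t) (at t)" and cont': "continuous_on UNIV \<eta>'"
    using test unfolding test_function_def by auto
  have cont: "continuous_on UNIV \<eta>" by (rule test_function_continuous[OF test])
  have eq: "left_RL_int \<gamma> a f x = integral (cbox 0 R) (\<lambda>r. ?m * f (x - r powr ?m))"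
    if "f = \<eta> \<or> f = \<eta>'" "x \<in> {a..b}" for f x
    unfolding R_def box_real using that zero \<open>a < c\<close> cont cont'
    by (intro left_RL_int_desingularized gamma ab) auto
  have powr_cont: "continuous_on {0..R} (\<lambda>r. r powr ?m)"
    using gamma by (intro continuous_on_powr' continuous_on_id continuous_on_const) auto
  have j: "continuous_on ({a..b} \<times> cbox 0 R) (\<lambda>(x, r). ?m * f (x - r powr ?m))"
    if "continuous_on UNIV f" for f :: "real \<Rightarrow> real"
    unfolding split_beta
    by (intro continuous_on_mult_left continuous_on_compose2[OF that] continuous_on_diff
        continuous_on_fst continuous_on_id continuous_on_compose2[OF powr_cont, of _ snd] continuous_on_snd) auto
  have "continuous_on {a..b} (\<lambda>x. integral (cbox 0 R) (\<lambda>r. ?m * \<eta>' (x - r powr ?m)))"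
    by (rule integral_continuous_on_param[OF j[OF cont']])
  then show "continuous_on {a..b} (left_RL_int \<gamma> a \<eta>')"
    by (rule continuous_on_eq) (simp add: eq)
  assume x: "x \<in> {a..b}"
  have "((\<lambda>x. integral (cbox 0 R) (\<lambda>r. ?m * \<eta> (x - r powr ?m))) has_real_derivative
      integral (cbox 0 R) (\<lambda>r. ?m * \<eta>' (x - r powr ?m))) (at x within {a..b})"
  proof (rule leibniz_rule_field_derivative[OF _ _ j[OF cont'] x])
    fix x r
    have "((\<lambda>x. \<eta> (x - r powr ?m)) has_real_derivative \<eta>' (x - r powr ?m) * 1) (at x within {a..b})"
      by (rule DERIV_chain2[OF der]) (auto intro!: derivative_eq_intros)
    then show "((\<lambda>x. ?m * \<eta> (x - r powr ?m)) has_real_derivative ?m * \<eta>' (x - r powr ?m))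
        (at x within {a..b})"
      using DERIV_cmult by fastforce
    show "(\<lambda>r. ?m * \<eta> (x - r powr ?m)) integrable_on cbox 0 R"
      using powr_cont by (intro integrable_continuous continuous_on_mult_left
          continuous_on_compose2[OF cont] continuous_on_diff continuous_on_const) auto
  qed auto
  then show "(left_RL_int \<gamma> a \<eta> has_real_derivative left_RL_int \<gamma> a \<eta>' x) (at x within {a..b})"
    unfolding eq[of \<eta>', OF disjI2[OF refl] x]
    by (rule has_field_derivative_transform_within[of _ _ _ _ 1]) (use x in \<open>simp_all add: eq\<close>)
qed

lemma right_RL_int_reflect: "right_RL_int \<gamma> d f x = left_RL_int \<gamma> (- d) (\<lambda>t. f (- t)) (- x)"
  unfolding right_RL_int_def left_RL_int_def
  using Henstock_Kurzweil_Integration.integral_reflect_real[of d x "\<lambda>t. (t - x) powr (- \<gamma>) * f t"]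
  by (simp add: minus_diff_commute[of x])

lemma right_RL_int_test_function:
  assumes gamma: "0 < \<gamma>" "\<gamma> < 1" and test: "test_function a b \<eta> \<eta>'" and ab: "a < b"
  shows "continuous_on {a..b} (right_RL_int \<gamma> b \<eta>')"
    and "x \<in> {a..b} \<Longrightarrow>
      (right_RL_int \<gamma> b \<eta> has_real_derivative right_RL_int \<gamma> b \<eta>' x) (at x within {a..b})"
proof -
  let ?e = "\<lambda>t. \<eta> (- t)" and ?e' = "\<lambda>t. - \<eta>' (- t)"
  note left = left_RL_int_test_function[OF gamma test_function_reflect[OF test]]
  \<comment> \<open>The derivative of the reflected function carries a minus sign, which cancels the
    one produced by the chain rule for \<open>uminus\<close> below.\<close>
  have neg: "right_RL_int \<gamma> b \<eta>' x = - left_RL_int \<gamma> (- b) ?e' (- x)" for x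
    unfolding right_RL_int_reflect by (simp add: left_RL_int_def)
  have "continuous_on {a..b} (\<lambda>x. - left_RL_int \<gamma> (- b) ?e' (- x))"
    using ab by (intro continuous_intros continuous_on_compose2[OF left(1)]) auto
  then show "continuous_on {a..b} (right_RL_int \<gamma> b \<eta>')"
    by (simp add: neg[abs_def])
  assume x: "x \<in> {a..b}"
  have "(left_RL_int \<gamma> (- b) ?e has_real_derivative left_RL_int \<gamma> (- b) ?e' (- x))
      (at (- x) within uminus ` {a..b})"
    using left(2)[of "- x"] x ab by simp
  from DERIV_image_chain[OF this, of "-1"]
  have "((\<lambda>x. left_RL_int \<gamma> (- b) ?e (- x)) has_real_derivative - left_RL_int \<gamma> (- b) ?e' (- x))
      (at x within {a..b})"
    by (simp add: o_def DERIV_minus[OF DERIV_ident])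
  then show "(right_RL_int \<gamma> b \<eta> has_real_derivative right_RL_int \<gamma> b \<eta>' x) (at x within {a..b})"
    unfolding neg right_RL_int_reflect[of _ _ \<eta>, abs_def] .
qed

section \<open>Fractional derivatives\<close>

lemma Gamma_one_minus_neq_0: "Gamma (1 - \<gamma>) \<noteq> 0" if "\<gamma> < 1" for \<gamma> :: real
  using Gamma_real_pos[of "1 - \<gamma>"] that by linarith

lemma right_RL_int_has_real_derivative:
  assumes "has_continuous_right_RL \<gamma> a b f" "\<gamma> < 1" "x \<in> {a..<b}"
  shows "(right_RL_int \<gamma> b f has_real_derivative - Gamma (1 - \<gamma>) * right_RL \<gamma> a b f x) (at x within {a..b})"
proof -
  have "right_RL_int \<gamma> b f differentiable (at x within {a..b})"
    using assms by (auto simp: has_continuous_right_RL_def)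
  then have "(right_RL_int \<gamma> b f has_real_derivative
      vector_derivative (right_RL_int \<gamma> b f) (at x within {a..b})) (at x within {a..b})"
    by (simp add: has_real_derivative_iff_has_vector_derivative vector_derivative_works[symmetric])
  moreover have "Gamma (1 - \<gamma>) \<noteq> 0"
    using assms by (simp add: Gamma_one_minus_neq_0)
  ultimately show ?thesis
    using assms by (simp add: right_RL_def right_RL_formula_def)
qed

lemma left_RL_int_has_real_derivative:
  assumes "has_continuous_left_RL \<gamma> a b f" "\<gamma> < 1" "x \<in> {a<..b}"
  shows "(left_RL_int \<gamma> a f has_real_derivative Gamma (1 - \<gamma>) * left_RL \<gamma> a b f x) (at x within {a..b})"
proof -
  have "left_RL_int \<gamma> a f differentiable (at x within {a..b})"
    using assms by (auto simp: has_continuous_left_RL_def)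
  then have "(left_RL_int \<gamma> a f has_real_derivative
      vector_derivative (left_RL_int \<gamma> a f) (at x within {a..b})) (at x within {a..b})"
    by (simp add: has_real_derivative_iff_has_vector_derivative vector_derivative_works[symmetric])
  moreover have "Gamma (1 - \<gamma>) \<noteq> 0"
    using assms by (simp add: Gamma_one_minus_neq_0)
  ultimately show ?thesis
    using assms by (simp add: left_RL_def left_RL_formula_def)
qed

lemma continuous_on_Icc_endpoint_limits:
  fixes D :: "real \<Rightarrow> real"
  assumes "a < b" "continuous_on {a..b} D"
  shows "(D \<longlongrightarrow> D a) (at_right a)" "(D \<longlongrightarrow> D b) (at_left b)"
proof -
  have "(D \<longlongrightarrow> D a) (at a within {a..b})" "(D \<longlongrightarrow> D b) (at b within {a..b})"
    using assms by (auto simp: continuous_on_def)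
  then show "(D \<longlongrightarrow> D a) (at_right a)" "(D \<longlongrightarrow> D b) (at_left b)"
    using at_within_Icc_at_right at_within_Icc_at_left assms by metis+
qed

text \<open>The value at the excluded endpoint is a limit, so it is determined by any continuous extension.\<close>

lemma left_RL_eqI:
  assumes ab: "a < b" and gamma: "\<gamma> < 1" and D: "continuous_on {a..b} D"
    and der: "\<And>x. x \<in> {a<..b} \<Longrightarrow>
      (left_RL_int \<gamma> a f has_real_derivative Gamma (1 - \<gamma>) * D x) (at x within {a..b})"
  shows "has_continuous_left_RL \<gamma> a b f" and "x \<in> {a..b} \<Longrightarrow> left_RL \<gamma> a b f x = D x"
proof -
  have G: "Gamma (1 - \<gamma>) \<noteq> 0"
    using gamma by (simp add: Gamma_one_minus_neq_0)
  have form: "left_RL_formula \<gamma> a b f x = D x" if "x \<in> {a<..b}" for x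
    using vector_derivative_within_closed_interval[OF ab _
        der[OF that, unfolded has_real_derivative_iff_has_vector_derivative]] that G
    by (simp add: left_RL_formula_def)
  have "eventually (\<lambda>x. D x = left_RL_formula \<gamma> a b f x) (at_right a)"
    using eventually_at_right_less[of a] eventually_at_right_real[OF ab]
    by eventually_elim (use form in auto)
  then have "(left_RL_formula \<gamma> a b f \<longlongrightarrow> D a) (at_right a)"
    using continuous_on_Icc_endpoint_limits(1)[OF ab D] by (rule Lim_transform_eventually[rotated])
  then have "Lim (at_right a) (left_RL_formula \<gamma> a b f) = D a"
    by (intro tendsto_Lim) auto
  then have eq: "left_RL \<gamma> a b f x = D x" if "x \<in> {a..b}" for x
    using that form[of x] by (auto simp: left_RL_def)
  then show "x \<in> {a..b} \<Longrightarrow> left_RL \<gamma> a b f x = D x" .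
  have "continuous_on {a..b} (left_RL \<gamma> a b f)"
    using D by (rule continuous_on_eq) (simp add: eq)
  then show "has_continuous_left_RL \<gamma> a b f"
    using der by (force simp: has_continuous_left_RL_def real_differentiable_def)
qed

lemma right_RL_eqI:
  assumes ab: "a < b" and gamma: "\<gamma> < 1" and D: "continuous_on {a..b} D"
    and der: "\<And>x. x \<in> {a..<b} \<Longrightarrow>
      (right_RL_int \<gamma> b f has_real_derivative - Gamma (1 - \<gamma>) * D x) (at x within {a..b})"
  shows "has_continuous_right_RL \<gamma> a b f" and "x \<in> {a..b} \<Longrightarrow> right_RL \<gamma> a b f x = D x"
proof -
  have G: "Gamma (1 - \<gamma>) \<noteq> 0"
    using gamma by (simp add: Gamma_one_minus_neq_0)
  have form: "right_RL_formula \<gamma> a b f x = D x" if "x \<in> {a..<b}" for x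
    using vector_derivative_within_closed_interval[OF ab _
        der[OF that, unfolded has_real_derivative_iff_has_vector_derivative]] that G
    by (simp add: right_RL_formula_def)
  have "eventually (\<lambda>x. D x = right_RL_formula \<gamma> a b f x) (at_left b)"
    using eventually_at_left_real[OF ab]
    by eventually_elim (use form in auto)
  then have "(right_RL_formula \<gamma> a b f \<longlongrightarrow> D b) (at_left b)"
    using continuous_on_Icc_endpoint_limits(2)[OF ab D] by (rule Lim_transform_eventually[rotated])
  then have "Lim (at_left b) (right_RL_formula \<gamma> a b f) = D b"
    by (intro tendsto_Lim) auto
  then have eq: "right_RL \<gamma> a b f x = D x" if "x \<in> {a..b}" for x
    using that form[of x] by (auto simp: right_RL_def)
  then show "x \<in> {a..b} \<Longrightarrow> right_RL \<gamma> a b f x = D x" .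
  have "continuous_on {a..b} (right_RL \<gamma> a b f)"
    using D by (rule continuous_on_eq) (simp add: eq)
  then show "has_continuous_right_RL \<gamma> a b f"
    using der by (force simp: has_continuous_right_RL_def real_differentiable_def)
qed

text \<open>Linearity is not formal: the integral, the derivative and the limit at \<open>a\<close>
  are all total operators, meaningful only after existence has been shown. The kernel integrals
  exist by continuity, and the combination of the two continuous derivatives identifies the new one,
  endpoint included. The relation between the functions is asked for on \<open>{a..b}\<close> only,
  so values outside stay irrelevant.\<close>

lemma left_RL_linear:
  fixes f h k :: "real \<Rightarrow> real"
  assumes ab: "a < b" and gamma: "\<gamma> < 1"
    and f: "continuous_on {a..b} f" "has_continuous_left_RL \<gamma> a b f"
    and h: "continuous_on {a..b} h" "has_continuous_left_RL \<gamma> a b h"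
    and k: "\<And>t. t \<in> {a..b} \<Longrightarrow> k t = r * f t + s * h t"
  shows "has_continuous_left_RL \<gamma> a b k"
    and "x \<in> {a..b} \<Longrightarrow>
      left_RL \<gamma> a b k x = r * left_RL \<gamma> a b f x + s * left_RL \<gamma> a b h x"
proof -
  have lin: "left_RL_int \<gamma> a k x = r * left_RL_int \<gamma> a f x + s * left_RL_int \<gamma> a h x"
    if "x \<in> {a..b}" for x
  proof -
    let ?k = "\<lambda>t. (x - t) powr (- \<gamma>)"
    have "(\<lambda>t. ?k t * f t) integrable_on {a..x}" "(\<lambda>t. ?k t * h t) integrable_on {a..x}"
      using left_RL_int_lborel(1)[OF gamma _ _ that] f h ab by auto
    then have "((\<lambda>t. r * (?k t * f t) + s * (?k t * h t)) has_integral
        r * left_RL_int \<gamma> a f x + s * left_RL_int \<gamma> a h x) {a..x}"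
      unfolding left_RL_int_def by (intro has_integral_add has_integral_mult_right integrable_integral)
    then have "((\<lambda>t. ?k t * k t) has_integral r * left_RL_int \<gamma> a f x + s * left_RL_int \<gamma> a h x) {a..x}"
      by (rule has_integral_eq[rotated]) (use k that in \<open>simp add: algebra_simps\<close>)
    then show ?thesis
      unfolding left_RL_int_def by (rule integral_unique)
  qed
  have D: "continuous_on {a..b} (\<lambda>x. r * left_RL \<gamma> a b f x + s * left_RL \<gamma> a b h x)"
    using f h by (intro continuous_intros) (auto simp: has_continuous_left_RL_def)
  have der: "(left_RL_int \<gamma> a k has_real_derivative
      Gamma (1 - \<gamma>) * (r * left_RL \<gamma> a b f x + s * left_RL \<gamma> a b h x)) (at x within {a..b})"
    if x: "x \<in> {a<..b}" for x
  proof -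
    have "((\<lambda>x. r * left_RL_int \<gamma> a f x + s * left_RL_int \<gamma> a h x) has_real_derivative
      r * (Gamma (1 - \<gamma>) * left_RL \<gamma> a b f x) + s * (Gamma (1 - \<gamma>) * left_RL \<gamma> a b h x)) (at x within {a..b})"
      using x by (intro DERIV_add DERIV_cmult left_RL_int_has_real_derivative f h gamma)
    then have "((\<lambda>x. r * left_RL_int \<gamma> a f x + s * left_RL_int \<gamma> a h x) has_real_derivative
      Gamma (1 - \<gamma>) * (r * left_RL \<gamma> a b f x + s * left_RL \<gamma> a b h x)) (at x within {a..b})"
      by (simp add: algebra_simps)
    then show ?thesis
      by (rule has_field_derivative_transform_within[of _ _ _ _ 1]) (use x in \<open>auto simp: lin\<close>)
  qed
  show "has_continuous_left_RL \<gamma> a b k"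
    and "x \<in> {a..b} \<Longrightarrow>
      left_RL \<gamma> a b k x = r * left_RL \<gamma> a b f x + s * left_RL \<gamma> a b h x"
    using left_RL_eqI[OF ab gamma D der] by auto
qed

lemma right_RL_linear:
  fixes f h k :: "real \<Rightarrow> real"
  assumes ab: "a < b" and gamma: "\<gamma> < 1"
    and f: "continuous_on {a..b} f" "has_continuous_right_RL \<gamma> a b f"
    and h: "continuous_on {a..b} h" "has_continuous_right_RL \<gamma> a b h"
    and k: "\<And>t. t \<in> {a..b} \<Longrightarrow> k t = r * f t + s * h t"
  shows "has_continuous_right_RL \<gamma> a b k"
    and "x \<in> {a..b} \<Longrightarrow>
      right_RL \<gamma> a b k x = r * right_RL \<gamma> a b f x + s * right_RL \<gamma> a b h x"
proof -
  have lin: "right_RL_int \<gamma> b k x = r * right_RL_int \<gamma> b f x + s * right_RL_int \<gamma> b h x"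
    if "x \<in> {a..b}" for x
  proof -
    let ?k = "\<lambda>t. (t - x) powr (- \<gamma>)"
    have "(\<lambda>t. ?k t * f t) integrable_on {x..b}" "(\<lambda>t. ?k t * h t) integrable_on {x..b}"
      using right_RL_int_lborel(1)[OF gamma _ _ that] f h ab by auto
    then have "((\<lambda>t. r * (?k t * f t) + s * (?k t * h t)) has_integral
        r * right_RL_int \<gamma> b f x + s * right_RL_int \<gamma> b h x) {x..b}"
      unfolding right_RL_int_def by (intro has_integral_add has_integral_mult_right integrable_integral)
    then have "((\<lambda>t. ?k t * k t) has_integral r * right_RL_int \<gamma> b f x + s * right_RL_int \<gamma> b h x) {x..b}"
      by (rule has_integral_eq[rotated]) (use k that in \<open>simp add: algebra_simps\<close>)
    then show ?thesis
      unfolding right_RL_int_def by (rule integral_unique)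
  qed
  have D: "continuous_on {a..b} (\<lambda>x. r * right_RL \<gamma> a b f x + s * right_RL \<gamma> a b h x)"
    using f h by (intro continuous_intros) (auto simp: has_continuous_right_RL_def)
  have der: "(right_RL_int \<gamma> b k has_real_derivative
      - Gamma (1 - \<gamma>) * (r * right_RL \<gamma> a b f x + s * right_RL \<gamma> a b h x)) (at x within {a..b})"
    if x: "x \<in> {a..<b}" for x
  proof -
    have "((\<lambda>x. r * right_RL_int \<gamma> b f x + s * right_RL_int \<gamma> b h x) has_real_derivative
      r * (- Gamma (1 - \<gamma>) * right_RL \<gamma> a b f x) + s * (- Gamma (1 - \<gamma>) * right_RL \<gamma> a b h x))
      (at x within {a..b})"
      using x by (intro DERIV_add DERIV_cmult right_RL_int_has_real_derivative f h gamma)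
    then have "((\<lambda>x. r * right_RL_int \<gamma> b f x + s * right_RL_int \<gamma> b h x) has_real_derivative
      - Gamma (1 - \<gamma>) * (r * right_RL \<gamma> a b f x + s * right_RL \<gamma> a b h x)) (at x within {a..b})"
      by (simp add: algebra_simps)
    then show ?thesis
      by (rule has_field_derivative_transform_within[of _ _ _ _ 1]) (use x in \<open>auto simp: lin\<close>)
  qed
  show "has_continuous_right_RL \<gamma> a b k"
    and "x \<in> {a..b} \<Longrightarrow>
      right_RL \<gamma> a b k x = r * right_RL \<gamma> a b f x + s * right_RL \<gamma> a b h x"
    using right_RL_eqI[OF ab gamma D der] by auto
qed

section \<open>Integration by parts, classical and fractional, against test functions\<close>

lemma test_function_by_parts:
  assumes test: "test_function a b \<eta> \<eta>'"
    and der: "\<And>x. x \<in> {a<..<b} \<Longrightarrow> (I has_real_derivative I' x) (at x)"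
    and int: "(\<lambda>x. \<eta>' x * I x) integrable_on {a..b}"
  shows "integral {a..b} (\<lambda>x. \<eta>' x * I x) = - integral {a..b} (\<lambda>x. \<eta> x * I' x)"
proof -
  obtain c d where cd: "a < c" "c < d" "d < b" and zero: "\<And>t. t \<notin> {c..d} \<Longrightarrow> \<eta> t = 0 \<and> \<eta>' t = 0"
    and d\<eta>: "\<And>t. (\<eta> has_real_derivative \<eta>' t) (at t)"
    using test unfolding test_function_def by auto
  \<comment> \<open>The midpoints lie strictly between the support of \<eta> and the ends of the
    interval: \<eta> vanishes at them, so there are no boundary terms, and \<open>I\<close> is still
    differentiable there, whereas nothing is known about it at \<open>a\<close> and
    \<open>b\<close>.\<close>
  let ?c = "(a + c) / 2" and ?d = "(d + b) / 2"
  have sub: "{?c..?d} \<subseteq> {a<..<b}" "{?c..?d} \<subseteq> {a..b}" using cd by auto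
  have vals: "\<eta> ?c = 0" "\<eta> ?d = 0" using zero[of ?c] zero[of ?d] cd by auto
  have eq: "integral {a..b} (\<lambda>x. f x * h x) = integral {?c..?d} (\<lambda>x. f x * h x)"
    if "f = \<eta> \<or> f = \<eta>'" for f h :: "real \<Rightarrow> real"
  proof -
    have "integral {a..b} (\<lambda>x. f x * h x) = integral {a..b} (\<lambda>x. if x \<in> {?c..?d} then f x * h x else 0)"
      by (rule integral_cong) (use that zero cd in fastforce)
    also have "\<dots> = integral {?c..?d} (\<lambda>x. f x * h x)"
      unfolding integral_restrict_Int using cd by (intro arg_cong[of _ _ "\<lambda>S. integral S _"]) auto
    finally show ?thesis .
  qed
  have "((\<lambda>x. \<eta>' x * I x) has_integral integral {?c..?d} (\<lambda>x. \<eta>' x * I x)) {?c..?d}"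
    by (intro integrable_integral integrable_on_subinterval[OF int sub(2)])
  then have "((\<lambda>x. I x * \<eta>' x) has_integral I ?d * \<eta> ?d - I ?c * \<eta> ?c - (- integral {?c..?d} (\<lambda>x. \<eta>' x * I x))) {?c..?d}"
    by (simp add: vals mult.commute)
  moreover have "continuous_on {?c..?d} I"
    using DERIV_isCont[OF der] sub by (intro continuous_at_imp_continuous_on) auto
  ultimately have "((\<lambda>x. I' x * \<eta> x) has_integral - integral {?c..?d} (\<lambda>x. \<eta>' x * I x)) {?c..?d}"
    using cd sub der d\<eta> test_function_continuous[OF test]
    by (intro integration_by_parts[OF bounded_bilinear_mult, of ?c ?d I \<eta> I' \<eta>'])
      (auto simp: has_real_derivative_iff_has_vector_derivative[symmetric] subset_iff)
  then have "integral {?c..?d} (\<lambda>x. \<eta> x * I' x) = - integral {?c..?d} (\<lambda>x. \<eta>' x * I x)"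
    by (intro integral_unique) (simp add: mult.commute)
  then show ?thesis using eq by simp
qed

text \<open>For a function vanishing near the lower endpoint the Riemann-Liouville derivative agrees
  with the Caputo derivative, where differentiation precedes the fractional integration. The latter
  is continuous up to the endpoint, which settles the value defined there as a limit.\<close>

lemma left_RL_test_function:
  assumes ab: "a < b" and gamma: "0 < \<gamma>" "\<gamma> < 1" and test: "test_function a b \<eta> \<eta>'"
  shows "has_continuous_left_RL \<gamma> a b \<eta>"
    and "x \<in> {a..b} \<Longrightarrow> left_RL \<gamma> a b \<eta> x = left_RL_int \<gamma> a \<eta>' x / Gamma (1 - \<gamma>)"
proof -
  note I = left_RL_int_test_function[OF gamma test ab]
  have G: "Gamma (1 - \<gamma>) \<noteq> 0"
    using gamma by (simp add: Gamma_one_minus_neq_0)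
  have D: "continuous_on {a..b} (\<lambda>x. left_RL_int \<gamma> a \<eta>' x / Gamma (1 - \<gamma>))"
    by (intro continuous_intros I) (simp add: G)
  have der: "(left_RL_int \<gamma> a \<eta> has_real_derivative
      Gamma (1 - \<gamma>) * (left_RL_int \<gamma> a \<eta>' x / Gamma (1 - \<gamma>))) (at x within {a..b})" if "x \<in> {a<..b}" for x
    using I(2)[of x] that G by simp
  show "has_continuous_left_RL \<gamma> a b \<eta>"
    and "x \<in> {a..b} \<Longrightarrow> left_RL \<gamma> a b \<eta> x = left_RL_int \<gamma> a \<eta>' x / Gamma (1 - \<gamma>)"
    using left_RL_eqI[OF ab gamma(2) D der] by auto
qed

lemma right_RL_test_function:
  assumes ab: "a < b" and gamma: "0 < \<gamma>" "\<gamma> < 1" and test: "test_function a b \<eta> \<eta>'"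
  shows "has_continuous_right_RL \<gamma> a b \<eta>"
    and "x \<in> {a..b} \<Longrightarrow> right_RL \<gamma> a b \<eta> x = - right_RL_int \<gamma> b \<eta>' x / Gamma (1 - \<gamma>)"
proof -
  note I = right_RL_int_test_function[OF gamma test ab]
  have G: "Gamma (1 - \<gamma>) \<noteq> 0"
    using gamma by (simp add: Gamma_one_minus_neq_0)
  have D: "continuous_on {a..b} (\<lambda>x. - right_RL_int \<gamma> b \<eta>' x / Gamma (1 - \<gamma>))"
    by (intro continuous_intros I) (simp add: G)
  have der: "(right_RL_int \<gamma> b \<eta> has_real_derivative
      - Gamma (1 - \<gamma>) * (- right_RL_int \<gamma> b \<eta>' x / Gamma (1 - \<gamma>))) (at x within {a..b})" if "x \<in> {a..<b}" for x
    using I(2)[of x] that G by simp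
  show "has_continuous_right_RL \<gamma> a b \<eta>"
    and "x \<in> {a..b} \<Longrightarrow> right_RL \<gamma> a b \<eta> x = - right_RL_int \<gamma> b \<eta>' x / Gamma (1 - \<gamma>)"
    using right_RL_eqI[OF ab gamma(2) D der] by auto
qed

text \<open>With the left derivative of \<eta> in Caputo form, Fubini moves the kernel onto
  \<open>p\<close>, and classical integration by parts moves the remaining derivative. The minus
  sign of that step cancels the one in the definition of the right derivative, so the adjoint of the
  left derivative is the right derivative, without a sign.\<close>

lemma fractional_by_parts_left:
  assumes ab: "a < b" and gamma: "0 < \<gamma>" "\<gamma> < 1" and test: "test_function a b \<eta> \<eta>'"
    and p: "continuous_on {a..b} p" "has_continuous_right_RL \<gamma> a b p"
  shows "integral {a..b} (\<lambda>x. p x * left_RL \<gamma> a b \<eta> x) = integral {a..b} (\<lambda>x. \<eta> x * right_RL \<gamma> a b p x)"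
proof -
  let ?G = "Gamma (1 - \<gamma>)"
  have G: "?G \<noteq> 0"
    using gamma by (simp add: Gamma_one_minus_neq_0)
  have cont: "continuous_on {a..b} \<eta>'"
    using test continuous_on_subset by (auto simp: test_function_def)
  note adj = RL_int_adjoint[OF gamma(2) less_imp_le[OF ab] p(1) cont]
  have "integral {a..b} (\<lambda>x. p x * left_RL \<gamma> a b \<eta> x) =
      integral {a..b} (\<lambda>x. p x * left_RL_int \<gamma> a \<eta>' x / ?G)"
    by (rule integral_cong) (simp add: left_RL_test_function[OF ab gamma test])
  also have "\<dots> = integral {a..b} (\<lambda>x. \<eta>' x * right_RL_int \<gamma> b p x) / ?G"
    by (simp add: adj(3))
  also have "integral {a..b} (\<lambda>x. \<eta>' x * right_RL_int \<gamma> b p x) =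
      - integral {a..b} (\<lambda>x. \<eta> x * (- ?G * right_RL \<gamma> a b p x))"
  proof (rule test_function_by_parts[OF test _ adj(2)])
    show "(right_RL_int \<gamma> b p has_real_derivative - ?G * right_RL \<gamma> a b p x) (at x)"
      if "x \<in> {a<..<b}" for x
      using right_RL_int_has_real_derivative[OF p(2) gamma(2), of x] that
      by (simp add: at_within_Icc_at)
  qed
  also have "\<dots> = ?G * integral {a..b} (\<lambda>x. \<eta> x * right_RL \<gamma> a b p x)"
    by (simp add: mult.left_commute[of _ ?G])
  finally show ?thesis using G by simp
qed

text \<open>Here the minus sign sits in the right derivative of \<eta> and again cancels that of the
  classical integration by parts; the adjointness of the fractional integrals is used with the roles
  of the two functions exchanged.\<close>

lemma fractional_by_parts_right:
  assumes ab: "a < b" and gamma: "0 < \<gamma>" "\<gamma> < 1" and test: "test_function a b \<eta> \<eta>'"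
    and p: "continuous_on {a..b} p" "has_continuous_left_RL \<gamma> a b p"
  shows "integral {a..b} (\<lambda>x. p x * right_RL \<gamma> a b \<eta> x) = integral {a..b} (\<lambda>x. \<eta> x * left_RL \<gamma> a b p x)"
proof -
  let ?G = "Gamma (1 - \<gamma>)"
  have G: "?G \<noteq> 0"
    using gamma by (simp add: Gamma_one_minus_neq_0)
  have cont: "continuous_on {a..b} \<eta>'"
    using test continuous_on_subset by (auto simp: test_function_def)
  note adj = RL_int_adjoint[OF gamma(2) less_imp_le[OF ab] cont p(1)]
  have "integral {a..b} (\<lambda>x. p x * right_RL \<gamma> a b \<eta> x) =
      integral {a..b} (\<lambda>x. - (p x * right_RL_int \<gamma> b \<eta>' x / ?G))"
    by (rule integral_cong) (simp add: right_RL_test_function[OF ab gamma test])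
  also have "\<dots> = - integral {a..b} (\<lambda>x. \<eta>' x * left_RL_int \<gamma> a p x) / ?G"
    by (simp add: adj(3))
  also have "integral {a..b} (\<lambda>x. \<eta>' x * left_RL_int \<gamma> a p x) =
      - integral {a..b} (\<lambda>x. \<eta> x * (?G * left_RL \<gamma> a b p x))"
  proof (rule test_function_by_parts[OF test _ adj(1)])
    show "(left_RL_int \<gamma> a p has_real_derivative ?G * left_RL \<gamma> a b p x) (at x)"
      if "x \<in> {a<..<b}" for x
      using left_RL_int_has_real_derivative[OF p(2) gamma(2), of x] that
      by (simp add: at_within_Icc_at)
  qed
  also have "- (- integral {a..b} (\<lambda>x. \<eta> x * (?G * left_RL \<gamma> a b p x))) / ?G =
      integral {a..b} (\<lambda>x. \<eta> x * left_RL \<gamma> a b p x)"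
    using G by (simp add: mult.left_commute[of _ ?G])
  finally show ?thesis .
qed

section \<open>The fundamental lemma\<close>

text \<open>The quadratic is positive exactly between \<open>c\<close> and \<open>d\<close>;
  squaring its positive part makes the gluing with 0 continuously differentiable, which is the
  smoothness that test functions require.\<close>

definition bump :: "real \<Rightarrow> real \<Rightarrow> real \<Rightarrow> real" where
  "bump c d t = (max 0 ((t - c) * (d - t)))\<^sup>2"

lemma max_0_square_has_derivative:
  "((\<lambda>s::real. (max 0 s)\<^sup>2) has_real_derivative 2 * max 0 s) (at s)"
proof (cases "s = 0")
  case True
  have "(\<lambda>h::real. max 0 h) \<midarrow>0\<rightarrow> max 0 0"
    by (intro tendsto_intros)
  moreover have "(max 0 h)\<^sup>2 / h = max 0 h" for h :: real
    by (auto simp: max_def power2_eq_square)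
  ultimately show ?thesis
    using True by (simp add: DERIV_def)
next
  case False
  show ?thesis
  proof (cases "s < 0")
    case True
    have "((\<lambda>_. 0) has_real_derivative 2 * max 0 s) (at s)"
      using True by simp
    then show ?thesis
      by (rule has_field_derivative_transform_within_open[of _ _ _ "{..<0}"]) (use True in auto)
  next
    case neg: False
    have "((\<lambda>s. s\<^sup>2) has_real_derivative 2 * max 0 s) (at s)"
      using neg by (auto intro!: derivative_eq_intros)
    then show ?thesis
      by (rule has_field_derivative_transform_within_open[of _ _ _ "{0<..}"]) (use neg False in auto)
  qed
qed

lemma test_function_bump:
  assumes "a < c" "c < d" "d < b"
  shows "test_function a b (bump c d) (\<lambda>t. 2 * max 0 ((t - c) * (d - t)) * (c + d - 2 * t))"
proof -
  have "(bump c d has_real_derivative 2 * max 0 ((t - c) * (d - t)) * (c + d - 2 * t)) (at t)" for t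
  proof -
    have "((\<lambda>t. (t - c) * (d - t)) has_real_derivative c + d - 2 * t) (at t)"
      by (auto intro!: derivative_eq_intros)
    from DERIV_chain2[OF max_0_square_has_derivative this] show ?thesis
      by (simp add: bump_def[abs_def])
  qed
  moreover have "continuous_on UNIV (\<lambda>t. 2 * max 0 ((t - c) * (d - t)) * (c + d - 2 * t))"
    by (intro continuous_intros)
  moreover have "bump c d t = 0 \<and> 2 * max 0 ((t - c) * (d - t)) * (c + d - 2 * t) = 0" if "t \<notin> {c..d}" for t
  proof -
    have "(t - c) * (d - t) \<le> 0" using that assms by (auto simp: mult_le_0_iff)
    then show ?thesis by (simp add: bump_def)
  qed
  ultimately show ?thesis using assms unfolding test_function_def by blast
qed

lemma fundamental_lemma_variations:
  fixes E :: "real \<Rightarrow> real"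
  assumes ab: "a < b" and E: "continuous_on {a..b} E"
    and zero: "\<And>\<eta> \<eta>'. test_function a b \<eta> \<eta>' \<Longrightarrow> integral {a..b} (\<lambda>x. \<eta> x * E x) = 0"
    and x: "x \<in> {a..b}"
  shows "E x = 0"
proof -
  \<comment> \<open>Stated for a general \<open>F\<close> so that it can be applied to
    \<open>E\<close> and to \<open>- E\<close>: a bump supported where \<open>F\<close> is positive
    gives a continuous nonnegative integrand with integral 0 that is positive at
    \<open>x\<close>.\<close>
  have pos: False if F: "continuous_on {a..b} F" and x: "x \<in> {a<..<b}" "F x > 0"
    and zero: "\<And>\<eta> \<eta>'. test_function a b \<eta> \<eta>' \<Longrightarrow> integral {a..b} (\<lambda>x. \<eta> x * F x) = 0" for F x
  proof -
    have "isCont F x"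
      using F x by (auto intro: continuous_on_interior)
    then have "eventually (\<lambda>t. F t > 0) (at x)"
      using x(2) by (auto simp: isCont_def intro: order_tendstoD)
    then obtain e where e: "e > 0" "\<And>t. t \<noteq> x \<Longrightarrow> dist t x < e \<Longrightarrow> F t > 0"
      by (auto simp: eventually_at)
    \<comment> \<open>Halving makes the inequalities strict: the closed interval
      \<open>{c..d}\<close> around \<open>x\<close> lies inside the open interval and inside the
      neighbourhood on which \<open>F\<close> is positive.\<close>
    define r where "r = Min {e, x - a, b - x} / 2"
    have r: "0 < r" "r < e" "r < x - a" "r < b - x"
      using e x by (auto simp: r_def min_def field_simps)
    define c where "c = x - r"
    define d where "d = x + r"
    have cd: "a < c" "c < x" "x < d" "d < b" using r by (auto simp: c_def d_def)
    have Fpos: "F t > 0" if "t \<in> {c..d}" for t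
      using e(2)[of t] x(2) that r by (cases "t = x") (auto simp: c_def d_def dist_real_def)
    have test: "test_function a b (bump c d) (\<lambda>t. 2 * max 0 ((t - c) * (d - t)) * (c + d - 2 * t))"
      using cd by (intro test_function_bump) auto
    have "(\<lambda>t. bump c d t * F t) integrable_on {a..b}"
      by (intro integrable_continuous_real continuous_intros test_function_continuous[OF test] F)
    then have hi: "((\<lambda>t. bump c d t * F t) has_integral 0) (cbox a b)"
      using zero[OF test] by (metis box_real(2) integrable_integral)
    have nonneg: "0 \<le> bump c d t * F t" for t
    proof (cases "t \<in> {c..d}")
      case True then show ?thesis using Fpos[of t] by (simp add: bump_def)
    next
      case False
      then have "(t - c) * (d - t) \<le> 0" using cd by (auto simp: mult_le_0_iff)
      then show ?thesis by (simp add: bump_def)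
    qed
    have "continuous_on (cbox a b) (\<lambda>t. bump c d t * F t)"
      using F unfolding box_real by (intro continuous_intros test_function_continuous[OF test])
    then have "bump c d x * F x = 0"
      using has_integral_0_cbox_imp_0[OF _ nonneg hi, of x] x ab by auto
    moreover have "bump c d x > 0" using cd by (simp add: bump_def)
    ultimately show False using x by simp
  qed
  have "E x = 0" if "x \<in> {a<..<b}" for x
  proof -
    have "\<not> E x > 0" using pos[OF E that] zero by blast
    moreover have "\<not> - E x > 0"
      using pos[of "\<lambda>x. - E x" x] E that zero by (auto intro!: continuous_intros)
    ultimately show ?thesis by simp
  qed
  \<comment> \<open>The test functions only see interior points; the endpoints follow by continuity
    of \<open>E\<close>.\<close>
  then show ?thesis
    using continuous_constant_on_closure[of "{a<..<b}" E 0 x] E x ab by auto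
qed

section \<open>Differentiability of the functional\<close>

text \<open>This is the induction step of "continuous partial derivatives imply differentiability".
  Only the partial derivative in the newly added variable has to be continuous, so one can start
  from the one-sided derivative in the time variable on a closed interval and add the three
  unrestricted variables one after another.\<close>

lemma has_derivative_Pair_real:
  fixes f :: "'a::real_normed_vector \<times> real \<Rightarrow> real"
  assumes f: "((\<lambda>p. f (p, r)) has_derivative f') (at p within X)"
    and D: "\<And>p r. p \<in> X \<Longrightarrow> ((\<lambda>r. f (p, r)) has_real_derivative D (p, r)) (at r)"
    and cont: "continuous_on (X \<times> UNIV) D" and "p \<in> X"
  shows "(f has_derivative (\<lambda>h. f' (fst h) + D (p, r) * snd h)) (at (p, r) within X \<times> UNIV)"
proof -
  have c: "continuous (at (p, r) within X \<times> UNIV) D"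
    using cont \<open>p \<in> X\<close> by (auto simp: continuous_on_eq_continuous_within)
  have "((\<lambda>(p, r). f (p, r)) has_derivative (\<lambda>(h, k). f' h + blinfun_mult_right (D (p, r)) k))
      (at (p, r) within X \<times> UNIV)"
  proof (rule has_derivative_partialsI[of "\<lambda>p r. f (p, r)", OF f])
    show "((\<lambda>r. f (p, r)) has_derivative blinfun_apply (blinfun_mult_right (D (p, r)))) (at r within UNIV)"
      if "p \<in> X" for p r
      using D[OF that] by (simp add: has_field_derivative_def)
    show "continuous (at (p, r) within X \<times> UNIV) (\<lambda>(p, r). blinfun_mult_right (D (p, r)))"
      using bounded_linear.continuous[OF bounded_linear_blinfun_mult_right c]
      by (simp add: case_prod_beta')
  qed auto
  then show ?thesis by (simp add: case_prod_beta')
qed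

definition lag_diff ::
    "real \<Rightarrow> real \<Rightarrow> lagrangian \<Rightarrow> real \<times> real \<times> real \<times> real \<Rightarrow> real \<times> real \<times> real \<Rightarrow> real" where
  "lag_diff a b F z q = partial_y a b F z * fst q + partial_u a b F z * fst (snd q)
     + partial_v a b F z * snd (snd q)"

lemma lag_basis: "(1, 0, 0, 0) \<in> (Basis :: (real \<times> real \<times> real \<times> real) set)"
    "(0, 1, 0, 0) \<in> (Basis :: (real \<times> real \<times> real \<times> real) set)"
    "(0, 0, 1, 0) \<in> (Basis :: (real \<times> real \<times> real \<times> real) set)"
    "(0, 0, 0, 1) \<in> (Basis :: (real \<times> real \<times> real \<times> real) set)"
  by (auto simp: Basis_prod_def zero_prod_def image_iff)

context
  fixes a b :: real and F :: lagrangian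
  assumes F: "has_continuous_partials (lag_dom a b) F"
begin

lemma continuous_partials:
  "continuous_on (lag_dom a b) (partial_y a b F)"
  "continuous_on (lag_dom a b) (partial_u a b F)"
  "continuous_on (lag_dom a b) (partial_v a b F)"
  using F lag_basis by (auto simp: has_continuous_partials_def partial_y_def partial_u_def partial_v_def)

lemma line_has_derivative:
  assumes "e \<in> Basis" "z \<in> lag_dom a b"
  shows "((\<lambda>t. F (z + t *\<^sub>R e)) has_real_derivative partial_within (lag_dom a b) e F z)
    (at 0 within {t. z + t *\<^sub>R e \<in> lag_dom a b})"
  using assms F unfolding partial_within_def has_continuous_partials_def
  by (simp add: has_real_derivative_iff_has_vector_derivative vector_derivative_works[symmetric])

lemma partials_has_derivative:
  assumes x: "x \<in> {a..b}"
  shows "((\<lambda>x. F (x, y, u, v)) has_real_derivative partial_within (lag_dom a b) (1, 0, 0, 0) F (x, y, u, v))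
      (at x within {a..b})"
    and "((\<lambda>y. F (x, y, u, v)) has_real_derivative partial_y a b F (x, y, u, v)) (at y)"
    and "((\<lambda>u. F (x, y, u, v)) has_real_derivative partial_u a b F (x, y, u, v)) (at u)"
    and "((\<lambda>v. F (x, y, u, v)) has_real_derivative partial_v a b F (x, y, u, v)) (at v)"
proof -
  have z: "(x, y, u, v) \<in> lag_dom a b" for y u v
    using x by (simp add: lag_dom_def)
  have "(+) x ` {t. x + t \<in> {a..b}} = {a..b}"
  proof (intro equalityI subsetI)
    show "t \<in> (+) x ` {t. x + t \<in> {a..b}}" if "t \<in> {a..b}" for t
      using that by (intro image_eqI[of _ _ "t - x"]) auto
  qed auto
  then show "((\<lambda>x. F (x, y, u, v)) has_real_derivative partial_within (lag_dom a b) (1, 0, 0, 0) F (x, y, u, v))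
      (at x within {a..b})"
    using line_has_derivative[OF lag_basis(1) z, of y u v]
      DERIV_at_within_shift[of "\<lambda>x. F (x, y, u, v)" _ x 0 "{t. x + t \<in> {a..b}}"]
    by (simp add: lag_dom_def)
  show "((\<lambda>y. F (x, y, u, v)) has_real_derivative partial_y a b F (x, y, u, v)) (at y)"
    using line_has_derivative[OF lag_basis(2) z, of y u v]
      DERIV_at_within_shift[of "\<lambda>y. F (x, y, u, v)" _ y 0 UNIV] x
    by (simp add: lag_dom_def partial_y_def)
  show "((\<lambda>u. F (x, y, u, v)) has_real_derivative partial_u a b F (x, y, u, v)) (at u)"
    using line_has_derivative[OF lag_basis(3) z, of y u v]
      DERIV_at_within_shift[of "\<lambda>u. F (x, y, u, v)" _ u 0 UNIV] x
    by (simp add: lag_dom_def partial_u_def)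
  show "((\<lambda>v. F (x, y, u, v)) has_real_derivative partial_v a b F (x, y, u, v)) (at v)"
    using line_has_derivative[OF lag_basis(4) z, of y u v]
      DERIV_at_within_shift[of "\<lambda>v. F (x, y, u, v)" _ v 0 UNIV] x
    by (simp add: lag_dom_def partial_v_def)
qed

lemma lagrangian_has_derivative:
  assumes "z \<in> lag_dom a b"
  shows "(F has_derivative (\<lambda>h. partial_within (lag_dom a b) (1, 0, 0, 0) F z * fst h + lag_diff a b F z (snd h)))
    (at z within lag_dom a b)"
proof -
  obtain x y u v where z: "z = (x, y, u, v)" by (cases z)
  have x: "x \<in> {a..b}" using assms by (simp add: z lag_dom_def)
  let ?c = "partial_within (lag_dom a b) (1, 0, 0, 0) F z"
  let ?X = "{a..b}"
  have X1: "((\<lambda>x. F (x, y, u, v)) has_derivative (\<lambda>h. ?c * h)) (at x within ?X)"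
    using partials_has_derivative(1)[OF x] by (simp add: has_field_derivative_def z)
  have X2: "((\<lambda>p. F (fst p, snd p, u, v)) has_derivative
      (\<lambda>h. ?c * fst h + partial_y a b F z * snd h)) (at (x, y) within ?X \<times> UNIV)"
  proof -
    have "continuous_on (?X \<times> UNIV) (\<lambda>p. partial_y a b F (fst p, snd p, u, v))"
      by (rule continuous_on_compose2[OF continuous_partials(1)])
        (auto simp: lag_dom_def intro!: continuous_intros)
    from has_derivative_Pair_real[of "\<lambda>p. F (fst p, snd p, u, v)", OF _ _ this x] show ?thesis
      using X1 partials_has_derivative(2) by (simp add: z)
  qed
  have X3: "((\<lambda>p. F (fst (fst p), snd (fst p), snd p, v)) has_derivative
      (\<lambda>h. ?c * fst (fst h) + partial_y a b F z * snd (fst h) + partial_u a b F z * snd h))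
      (at ((x, y), u) within (?X \<times> UNIV) \<times> UNIV)"
  proof -
    have "continuous_on ((?X \<times> UNIV) \<times> UNIV) (\<lambda>p. partial_u a b F (fst (fst p), snd (fst p), snd p, v))"
      by (rule continuous_on_compose2[OF continuous_partials(2)])
        (auto simp: lag_dom_def intro!: continuous_intros)
    from has_derivative_Pair_real[of "\<lambda>p. F (fst (fst p), snd (fst p), snd p, v)", OF _ _ this, of u _ "(x, y)"]
    show ?thesis
      using X2 partials_has_derivative(3) x by (auto simp: z)
  qed
  have X4: "((\<lambda>p. F (fst (fst (fst p)), snd (fst (fst p)), snd (fst p), snd p)) has_derivative
      (\<lambda>h. ?c * fst (fst (fst h)) + partial_y a b F z * snd (fst (fst h)) + partial_u a b F z * snd (fst h)
        + partial_v a b F z * snd h)) (at (((x, y), u), v) within ((?X \<times> UNIV) \<times> UNIV) \<times> UNIV)"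
  proof -
    have "continuous_on (((?X \<times> UNIV) \<times> UNIV) \<times> UNIV)
        (\<lambda>p. partial_v a b F (fst (fst (fst p)), snd (fst (fst p)), snd (fst p), snd p))"
      by (rule continuous_on_compose2[OF continuous_partials(3)])
        (auto simp: lag_dom_def intro!: continuous_intros)
    from has_derivative_Pair_real[of "\<lambda>p. F (fst (fst (fst p)), snd (fst (fst p)), snd (fst p), snd p)",
        OF _ _ this, of v _ "((x, y), u)"]
    show ?thesis
      using X3 partials_has_derivative(4) x by (auto simp: z)
  qed
  \<comment> \<open>Adding variables on the right produces left-nested pairs, while the arguments of
    a Lagrangian are right-nested; \<open>?r\<close> is the linear map that reassociates
    them.\<close>
  let ?r = "\<lambda>h :: real \<times> real \<times> real \<times> real. (((fst h, fst (snd h)), fst (snd (snd h))), snd (snd (snd h)))"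
  have r: "(?r has_derivative ?r) (at z within lag_dom a b)"
    by (intro bounded_linear_imp_has_derivative bounded_linear_intros)
  have sub: "?r ` lag_dom a b \<subseteq> ((?X \<times> UNIV) \<times> UNIV) \<times> UNIV"
    by (auto simp: lag_dom_def)
  have rz: "?r z = (((x, y), u), v)" by (simp add: z)
  have "((\<lambda>p. F (fst (fst (fst p)), snd (fst (fst p)), snd (fst p), snd p)) has_derivative
      (\<lambda>h. ?c * fst (fst (fst h)) + partial_y a b F z * snd (fst (fst h)) + partial_u a b F z * snd (fst h)
        + partial_v a b F z * snd h)) (at (?r z) within ?r ` lag_dom a b)"
    unfolding rz by (rule has_derivative_subset[OF X4 sub])
  from has_derivative_in_compose[OF r this] show ?thesis
    by (simp add: lag_diff_def add.assoc)
qed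

lemma continuous_on_lagrangian: "continuous_on (lag_dom a b) F"
  unfolding continuous_on_eq_continuous_within
  using lagrangian_has_derivative has_derivative_continuous by blast

lemma lagrangian_slice_has_derivative:
  assumes "x \<in> {a..b}"
  shows "((\<lambda>q. F (x, q)) has_derivative lag_diff a b F (x, q)) (at q)"
proof -
  let ?c = "partial_within (lag_dom a b) (1, 0, 0, 0) F (x, q)"
  have i: "((\<lambda>q. (x, q)) has_derivative (\<lambda>h. (0, h))) (at q)"
    by (auto intro!: derivative_eq_intros)
  have "(F has_derivative (\<lambda>h. ?c * fst h + lag_diff a b F (x, q) (snd h)))
      (at (x, q) within range (\<lambda>q. (x, q)))"
    using assms by (intro has_derivative_subset[OF lagrangian_has_derivative]) (auto simp: lag_dom_def)
  from has_derivative_in_compose[OF i this] show ?thesis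
    by simp
qed

text \<open>Differentiation under the integral sign over a compact range. The curves are arbitrary
  continuous ones in three-dimensional space, because fractional differentiation is linear and
  therefore enters the variation only through fixed curves \<open>p\<^sub>1\<close> and
  \<open>p\<^sub>2\<close>. The derivative is obtained at every \<open>e\<close>, which yields the
  continuity in the parameters required for openness.\<close>

lemma action_variation_has_derivative:
  fixes w p\<^sub>1 p\<^sub>2 :: "real \<Rightarrow> real \<times> real \<times> real"
  assumes w: "continuous_on {a..b} w"
    and p1: "continuous_on {a..b} p\<^sub>1" and p2: "continuous_on {a..b} p\<^sub>2"
  defines "W \<equiv> \<lambda>e x. (x, w x + fst e *\<^sub>R p\<^sub>1 x + snd e *\<^sub>R p\<^sub>2 x)"
  shows "((\<lambda>e. integral {a..b} (\<lambda>x. F (W e x))) has_derivative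
    (\<lambda>h. fst h * integral {a..b} (\<lambda>x. lag_diff a b F (W e x) (p\<^sub>1 x))
       + snd h * integral {a..b} (\<lambda>x. lag_diff a b F (W e x) (p\<^sub>2 x)))) (at e)"
proof -
  let ?d = "\<lambda>p e x. lag_diff a b F (W e x) (p x)"
  \<comment> \<open>The Leibniz rule wants the derivative as a continuous family of bounded linear
    maps; it is written in terms of the two coordinate projections of the parameter plane.\<close>
  let ?fx = "\<lambda>e x. ?d p\<^sub>1 e x *\<^sub>R fst_blinfun + ?d p\<^sub>2 e x *\<^sub>R (snd_blinfun :: (real \<times> real) \<Rightarrow>\<^sub>L real)"
  have Wdom: "(\<lambda>(e, x). W e x) ` (UNIV \<times> {a..b}) \<subseteq> lag_dom a b"
    by (auto simp: W_def lag_dom_def)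
  have snd_c: "continuous_on (UNIV \<times> {a..b}) (\<lambda>z. p (snd z))"
    if "continuous_on {a..b} p" for p :: "real \<Rightarrow> real \<times> real \<times> real"
    by (rule continuous_on_compose2[OF that continuous_on_snd[OF continuous_on_id]]) auto
  have W: "continuous_on (UNIV \<times> {a..b}) (\<lambda>(e, x). W e x)"
    unfolding W_def split_beta by (intro continuous_intros snd_c w p1 p2)
  note part = continuous_partials[THEN continuous_on_compose2, OF W Wdom]
  have d: "continuous_on (UNIV \<times> {a..b}) (\<lambda>(e, x). ?d p e x)" if "continuous_on {a..b} p" for p
    using part snd_c[OF that] unfolding lag_diff_def split_beta by (intro continuous_intros) auto
  have d_int: "?d p e integrable_on {a..b}" if "continuous_on {a..b} p" for p e
  proof -
    have "continuous_on {a..b} (\<lambda>x. (\<lambda>(e, x). ?d p e x) (e, x))"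
      by (rule continuous_on_compose2[OF d[OF that]]) (auto intro!: continuous_intros)
    then show ?thesis by (intro integrable_continuous_real) simp
  qed
  have "((\<lambda>e. integral (cbox a b) (\<lambda>x. F (W e x))) has_derivative integral (cbox a b) (?fx e)) (at e)"
  proof (rule leibniz_rule)
    fix e x assume x: "x \<in> cbox a b"
    let ?w = "\<lambda>e. w x + fst e *\<^sub>R p\<^sub>1 x + snd e *\<^sub>R p\<^sub>2 x"
    have w': "(?w has_derivative (\<lambda>h. fst h *\<^sub>R p\<^sub>1 x + snd h *\<^sub>R p\<^sub>2 x)) (at e)"
      by (auto intro!: derivative_eq_intros)
    have "((\<lambda>e. F (x, ?w e)) has_derivative
        (\<lambda>h. lag_diff a b F (x, ?w e) (fst h *\<^sub>R p\<^sub>1 x + snd h *\<^sub>R p\<^sub>2 x))) (at e)"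
      using has_derivative_compose[OF w' lagrangian_slice_has_derivative] x by simp
    moreover have "(\<lambda>h. lag_diff a b F (x, ?w e) (fst h *\<^sub>R p\<^sub>1 x + snd h *\<^sub>R p\<^sub>2 x)) = blinfun_apply (?fx e x)"
      by (auto simp: fun_eq_iff lag_diff_def W_def blinfun.add_left blinfun.scaleR_left algebra_simps)
    ultimately show "((\<lambda>e. F (W e x)) has_derivative blinfun_apply (?fx e x)) (at e)"
      by (simp add: W_def)
  next
    fix e
    have "continuous_on {a..b} (\<lambda>x. F ((\<lambda>(e, x). W e x) (e, x)))"
      by (rule continuous_on_compose2[OF continuous_on_compose2[OF continuous_on_lagrangian W Wdom]])
        (auto intro!: continuous_intros)
    then show "(\<lambda>x. F (W e x)) integrable_on cbox a b"
      by (intro integrable_continuous) simp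
  next
    show "continuous_on (UNIV \<times> cbox a b) (\<lambda>(e, x). ?fx e x)"
      using d[OF p1] d[OF p2] unfolding split_beta box_real by (intro continuous_intros)
  qed auto
  moreover have "blinfun_apply (integral (cbox a b) (?fx e)) =
      (\<lambda>h. fst h * integral {a..b} (?d p\<^sub>1 e) + snd h * integral {a..b} (?d p\<^sub>2 e))"
  proof
    fix h
    have "(\<lambda>x. ?d p e x *\<^sub>R c) integrable_on {a..b}" if "continuous_on {a..b} p" for p and c :: "(real \<times> real) \<Rightarrow>\<^sub>L real"
      using integrable_linear[OF d_int[OF that, of e] bounded_linear_scaleR_left[of c]] by (simp add: o_def)
    then have "?fx e integrable_on {a..b}"
      using p1 p2 by (intro integrable_add) auto
    then have "blinfun_apply (integral {a..b} (?fx e)) h = integral {a..b} (\<lambda>x. ?d p\<^sub>1 e x * fst h + ?d p\<^sub>2 e x * snd h)"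
      by (simp add: blinfun_apply_integral blinfun.add_left blinfun.scaleR_left)
    also have "\<dots> = integral {a..b} (\<lambda>x. ?d p\<^sub>1 e x * fst h) + integral {a..b} (\<lambda>x. ?d p\<^sub>2 e x * snd h)"
      using d_int p1 p2 by (intro Henstock_Kurzweil_Integration.integral_add integrable_on_mult_left)
    finally show "blinfun_apply (integral (cbox a b) (?fx e)) h =
      fst h * integral {a..b} (?d p\<^sub>1 e) + snd h * integral {a..b} (?d p\<^sub>2 e)" by simp
  qed
  ultimately show ?thesis by simp
qed

end

section \<open>The first variation\<close>

text \<open>This allows meaningless values in the slot of an absent fractional derivative to be
  replaced at will, both in \<open>F\<close> and in its partial derivatives.\<close>

lemma lagrangian_irrelevant_arguments:
  assumes x: "x \<in> {a..b}"
    and u: "depends_on_u a b F \<Longrightarrow> u = u'" and v: "depends_on_v a b F \<Longrightarrow> v = v'"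
  shows "F (x, y, u, v) = F (x, y, u', v')"
    and "partial_y a b F (x, y, u, v) = partial_y a b F (x, y, u', v')"
    and "partial_u a b F (x, y, u, v) = partial_u a b F (x, y, u', v')"
    and "partial_v a b F (x, y, u, v) = partial_v a b F (x, y, u', v')"
proof -
  have F: "F (x, y, u, v) = F (x, y, u', v')"
    if "depends_on_u a b F \<Longrightarrow> u = u'" "depends_on_v a b F \<Longrightarrow> v = v'" for y u u' v v'
  proof -
    have "F (x, y, u, v) = F (x, y, u', v)"
      using that(1) x unfolding depends_on_u_def by blast
    also have "\<dots> = F (x, y, u', v')"
      using that(2) x unfolding depends_on_v_def by blast
    finally show ?thesis .
  qed
  show "F (x, y, u, v) = F (x, y, u', v')" by (rule F[OF u v])
  \<comment> \<open>The two base points are moved along parallel lines, and each moved pair again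
    differs only in arguments that \<open>F\<close> ignores. The restrictions to the lines are thus
    equal as functions, and so are their derivatives.\<close>
  have "(\<lambda>t. F (x, y + t * p, u + t * q, v + t * r)) = (\<lambda>t. F (x, y + t * p, u' + t * q, v' + t * r))" for p q r
    by (rule ext, rule F) (use u v in auto)
  then have "partial_within (lag_dom a b) (0, p, q, r) F (x, y, u, v) =
      partial_within (lag_dom a b) (0, p, q, r) F (x, y, u', v')" for p q r
    by (simp add: partial_within_def lag_dom_def)
  then show "partial_y a b F (x, y, u, v) = partial_y a b F (x, y, u', v')"
    and "partial_u a b F (x, y, u, v) = partial_u a b F (x, y, u', v')"
    and "partial_v a b F (x, y, u, v) = partial_v a b F (x, y, u', v')"
    by (simp_all add: partial_y_def partial_u_def partial_v_def)
qed

lemma partials_linear: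
  assumes F: "has_continuous_partials (lag_dom a b) F" and G: "has_continuous_partials (lag_dom a b) G"
    and z: "z \<in> lag_dom a b"
  shows "partial_y a b (\<lambda>z. r * F z - s * G z) z = r * partial_y a b F z - s * partial_y a b G z"
    and "partial_u a b (\<lambda>z. r * F z - s * G z) z = r * partial_u a b F z - s * partial_u a b G z"
    and "partial_v a b (\<lambda>z. r * F z - s * G z) z = r * partial_v a b F z - s * partial_v a b G z"
proof -
  have "partial_within (lag_dom a b) (0, e) (\<lambda>z. r * F z - s * G z) z =
      r * partial_within (lag_dom a b) (0, e) F z - s * partial_within (lag_dom a b) (0, e) G z"
    if e: "(0 :: real, e) \<in> Basis" for e :: "real \<times> real \<times> real"
  proof -
    \<comment> \<open>Lines in the last three directions never leave the strip, so the derivative is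
      two-sided and uniquely determined.\<close>
    have U: "{t. z + t *\<^sub>R (0, e) \<in> lag_dom a b} = UNIV"
      using z by (cases z) (auto simp: lag_dom_def)
    show ?thesis
      using DERIV_diff[OF DERIV_cmult[OF line_has_derivative[OF F e z]] DERIV_cmult[OF line_has_derivative[OF G e z]]]
      unfolding partial_within_def[of _ _ "\<lambda>z. r * F z - s * G z"] U has_real_derivative_iff_has_vector_derivative
      by (intro vector_derivative_at)
  qed
  then show "partial_y a b (\<lambda>z. r * F z - s * G z) z = r * partial_y a b F z - s * partial_y a b G z"
    and "partial_u a b (\<lambda>z. r * F z - s * G z) z = r * partial_u a b F z - s * partial_u a b G z"
    and "partial_v a b (\<lambda>z. r * F z - s * G z) z = r * partial_v a b F z - s * partial_v a b G z"
    using lag_basis by (simp_all add: partial_y_def partial_u_def partial_v_def)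
qed

definition euler_lagrange ::
    "real \<Rightarrow> real \<Rightarrow> real \<Rightarrow> real \<Rightarrow> lagrangian \<Rightarrow> (real \<Rightarrow> real) \<Rightarrow> real \<Rightarrow> real" where
  "euler_lagrange \<alpha> \<beta> a b F y x =
     partial_y a b F (along \<alpha> \<beta> a b y x)
     + right_RL \<alpha> a b (\<lambda>s. partial_u a b F (along \<alpha> \<beta> a b y s)) x
     + left_RL \<beta> a b (\<lambda>s. partial_v a b F (along \<alpha> \<beta> a b y s)) x"

locale fractional_problem =
  fixes \<alpha> \<beta> a b :: real and L g :: lagrangian and y :: "real \<Rightarrow> real"
  assumes ab: "a < b" and alpha: "0 < \<alpha>" "\<alpha> < 1" and beta: "0 < \<beta>" "\<beta> < 1"
    and L: "has_continuous_partials (lag_dom a b) L" and g: "has_continuous_partials (lag_dom a b) g"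
    and y: "y \<in> admissible \<alpha> \<beta> a b L g"
begin

text \<open>
  Without regularity of \<open>y\<close> the values of an absent fractional derivative are junk and need not be
  continuous, so they are replaced by \<open>0\<close>.
\<close>

definition jet :: "real \<Rightarrow> real \<times> real \<times> real" where
  "jet x = (y x, if left_present a b L g then left_RL \<alpha> a b y x else 0,
     if right_present a b L g then right_RL \<beta> a b y x else 0)"

text \<open>No replacement by 0 as in \<open>jet\<close>: a test function has both fractional
  derivatives in any case, and a component that is absent from the problem is ignored by
  \<open>L\<close> and \<open>g\<close>.\<close>

definition test_jet :: "(real \<Rightarrow> real) \<Rightarrow> real \<Rightarrow> real \<times> real \<times> real" where
  "test_jet \<eta> x = (\<eta> x, left_RL \<alpha> a b \<eta> x, right_RL \<beta> a b \<eta> x)"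

lemma continuous_on_jet: "continuous_on {a..b} jet"
proof -
  have "continuous_on {a..b} (\<lambda>x. if left_present a b L g then left_RL \<alpha> a b y x else 0)"
    "continuous_on {a..b} (\<lambda>x. if right_present a b L g then right_RL \<beta> a b y x else 0)"
    by (cases "left_present a b L g"; cases "right_present a b L g"; use y in
        \<open>simp add: admissible_def has_continuous_left_RL_def has_continuous_right_RL_def\<close>)+
  then show ?thesis
    using y unfolding jet_def[abs_def] admissible_def by (intro continuous_on_Pair) auto
qed

lemma continuous_on_test_jet:
  assumes "test_function a b \<eta> \<eta>'"
  shows "continuous_on {a..b} (test_jet \<eta>)"
  using left_RL_test_function(1)[OF ab alpha assms] right_RL_test_function(1)[OF ab beta assms]
  unfolding test_jet_def[abs_def] has_continuous_left_RL_def has_continuous_right_RL_def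
  by (intro continuous_on_Pair test_function_continuous[OF assms]) auto

lemma along_jet:
  assumes F: "F = L \<or> F = g" and x: "x \<in> {a..b}"
  shows "F (along \<alpha> \<beta> a b y x) = F (x, jet x)"
    and "partial_y a b F (along \<alpha> \<beta> a b y x) = partial_y a b F (x, jet x)"
    and "partial_u a b F (along \<alpha> \<beta> a b y x) = partial_u a b F (x, jet x)"
    and "partial_v a b F (along \<alpha> \<beta> a b y x) = partial_v a b F (x, jet x)"
proof -
  have p: "depends_on_u a b F \<Longrightarrow> left_present a b L g" "depends_on_v a b F \<Longrightarrow> right_present a b L g"
    using F by (auto simp: left_present_def right_present_def)
  show "F (along \<alpha> \<beta> a b y x) = F (x, jet x)"
    and "partial_y a b F (along \<alpha> \<beta> a b y x) = partial_y a b F (x, jet x)"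
    and "partial_u a b F (along \<alpha> \<beta> a b y x) = partial_u a b F (x, jet x)"
    and "partial_v a b F (along \<alpha> \<beta> a b y x) = partial_v a b F (x, jet x)"
    unfolding along_def jet_def by (rule lagrangian_irrelevant_arguments[OF x]; use p in simp)+
qed

text \<open>The curve \<open>along\<close> itself may be discontinuous in an absent component, but
  the partial derivatives do not notice this, so \<open>jet\<close> can be substituted for
  it.\<close>

lemma continuous_on_partials_along:
  assumes F: "F = L \<or> F = g"
  shows "continuous_on {a..b} (\<lambda>x. partial_y a b F (along \<alpha> \<beta> a b y x))"
    and "continuous_on {a..b} (\<lambda>x. partial_u a b F (along \<alpha> \<beta> a b y x))"
    and "continuous_on {a..b} (\<lambda>x. partial_v a b F (along \<alpha> \<beta> a b y x))"
proof -
  have cont: "has_continuous_partials (lag_dom a b) F" using F L g by auto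
  have j: "continuous_on {a..b} (\<lambda>x. (x, jet x))"
    by (intro continuous_intros continuous_on_jet)
  have s: "(\<lambda>x. (x, jet x)) ` {a..b} \<subseteq> lag_dom a b" by (auto simp: lag_dom_def)
  note c = continuous_partials[OF cont, THEN continuous_on_compose2, OF j s]
  show "continuous_on {a..b} (\<lambda>x. partial_y a b F (along \<alpha> \<beta> a b y x))"
    and "continuous_on {a..b} (\<lambda>x. partial_u a b F (along \<alpha> \<beta> a b y x))"
    and "continuous_on {a..b} (\<lambda>x. partial_v a b F (along \<alpha> \<beta> a b y x))"
    by (rule continuous_on_eq[OF c(1)] continuous_on_eq[OF c(2)] continuous_on_eq[OF c(3)],
        simp add: along_jet[OF F])+
qed

lemma continuous_on_euler_lagrange:
  assumes F: "F = L \<or> F = g" and reg: "regular_along \<alpha> \<beta> a b F y"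
  shows "continuous_on {a..b} (euler_lagrange \<alpha> \<beta> a b F y)"
  using reg unfolding euler_lagrange_def[abs_def] regular_along_def has_continuous_left_RL_def has_continuous_right_RL_def
  by (intro continuous_intros continuous_on_partials_along[OF F]) auto

text \<open>The differential is taken at \<open>jet\<close>, but regularity is assumed for the
  partial derivatives at \<open>along\<close>. After passing from one to the other, the terms in
  \<open>u\<close> and \<open>v\<close> are treated by fractional integration by parts, which leaves
  \<eta> as a common factor.\<close>

lemma first_variation:
  assumes F: "F = L \<or> F = g" and reg: "regular_along \<alpha> \<beta> a b F y"
    and test: "test_function a b \<eta> \<eta>'"
  shows "integral {a..b} (\<lambda>x. lag_diff a b F (x, jet x) (test_jet \<eta> x)) =
    integral {a..b} (\<lambda>x. \<eta> x * euler_lagrange \<alpha> \<beta> a b F y x)"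
proof -
  let ?y = "\<lambda>x. partial_y a b F (along \<alpha> \<beta> a b y x)"
  let ?u = "\<lambda>x. partial_u a b F (along \<alpha> \<beta> a b y x)"
  let ?v = "\<lambda>x. partial_v a b F (along \<alpha> \<beta> a b y x)"
  note c = continuous_on_partials_along[OF F]
  note l = left_RL_test_function(1)[OF ab alpha test] and r = right_RL_test_function(1)[OF ab beta test]
  note \<eta> = test_function_continuous[OF test]
  have int: "(\<lambda>x. f x * h x) integrable_on {a..b}" if "continuous_on {a..b} f" "continuous_on {a..b} h"
    for f h :: "real \<Rightarrow> real"
    using that by (intro integrable_continuous_real continuous_on_mult)
  have "integral {a..b} (\<lambda>x. lag_diff a b F (x, jet x) (test_jet \<eta> x)) =
    integral {a..b} (\<lambda>x. ?y x * \<eta> x + ?u x * left_RL \<alpha> a b \<eta> x + ?v x * right_RL \<beta> a b \<eta> x)"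
    by (rule integral_cong) (simp add: lag_diff_def test_jet_def along_jet[OF F])
  also have "\<dots> = integral {a..b} (\<lambda>x. ?y x * \<eta> x) + integral {a..b} (\<lambda>x. ?u x * left_RL \<alpha> a b \<eta> x)
      + integral {a..b} (\<lambda>x. ?v x * right_RL \<beta> a b \<eta> x)"
    using c \<eta> l r unfolding has_continuous_left_RL_def has_continuous_right_RL_def
    by (subst Henstock_Kurzweil_Integration.integral_add; (intro integrable_add int)?; auto)+
  also have "integral {a..b} (\<lambda>x. ?u x * left_RL \<alpha> a b \<eta> x) = integral {a..b} (\<lambda>x. \<eta> x * right_RL \<alpha> a b ?u x)"
    using reg by (intro fractional_by_parts_left[OF ab alpha test c(2)]) (simp add: regular_along_def)
  also have "integral {a..b} (\<lambda>x. ?v x * right_RL \<beta> a b \<eta> x) = integral {a..b} (\<lambda>x. \<eta> x * left_RL \<beta> a b ?v x)"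
    using reg by (intro fractional_by_parts_right[OF ab beta test c(3)]) (simp add: regular_along_def)
  also have "integral {a..b} (\<lambda>x. ?y x * \<eta> x) = integral {a..b} (\<lambda>x. \<eta> x * ?y x)"
    by (simp add: mult.commute)
  also have "integral {a..b} (\<lambda>x. \<eta> x * ?y x) + integral {a..b} (\<lambda>x. \<eta> x * right_RL \<alpha> a b ?u x)
      + integral {a..b} (\<lambda>x. \<eta> x * left_RL \<beta> a b ?v x) =
      integral {a..b} (\<lambda>x. \<eta> x * ?y x + \<eta> x * right_RL \<alpha> a b ?u x + \<eta> x * left_RL \<beta> a b ?v x)"
    using c \<eta> reg unfolding regular_along_def has_continuous_left_RL_def has_continuous_right_RL_def
    by (subst Henstock_Kurzweil_Integration.integral_add; (intro integrable_add int)?; auto)+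
  also have "\<dots> = integral {a..b} (\<lambda>x. \<eta> x * euler_lagrange \<alpha> \<beta> a b F y x)"
    by (simp add: euler_lagrange_def algebra_simps)
  finally show ?thesis .
qed

section \<open>Two-parameter variations by a pair of test functions\<close>

context
  fixes \<eta>\<^sub>1 \<eta>\<^sub>1' \<eta>\<^sub>2 \<eta>\<^sub>2' :: "real \<Rightarrow> real"
  assumes test: "test_function a b \<eta>\<^sub>1 \<eta>\<^sub>1'" "test_function a b \<eta>\<^sub>2 \<eta>\<^sub>2'"
begin

definition variation :: "real \<times> real \<Rightarrow> real \<Rightarrow> real" where
  "variation e x = y x + (fst e * \<eta>\<^sub>1 x + snd e * \<eta>\<^sub>2 x)"

lemma left_RL_variation:
  assumes "left_present a b L g"
  shows "has_continuous_left_RL \<alpha> a b (variation e)"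
    and "x \<in> {a..b} \<Longrightarrow> left_RL \<alpha> a b (variation e) x =
      left_RL \<alpha> a b y x + fst e * left_RL \<alpha> a b \<eta>\<^sub>1 x + snd e * left_RL \<alpha> a b \<eta>\<^sub>2 x"
proof -
  let ?h = "\<lambda>x. fst e * \<eta>\<^sub>1 x + snd e * \<eta>\<^sub>2 x"
  note h = left_RL_linear[OF ab alpha(2) test_function_continuous[OF test(1)]
      left_RL_test_function(1)[OF ab alpha test(1)] test_function_continuous[OF test(2)]
      left_RL_test_function(1)[OF ab alpha test(2)], of ?h "fst e" "snd e", OF refl]
  have hc: "continuous_on {a..b} ?h"
    by (intro continuous_intros test_function_continuous[OF test(1)] test_function_continuous[OF test(2)])
  have "continuous_on {a..b} y" "has_continuous_left_RL \<alpha> a b y"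
    using y assms by (auto simp: admissible_def)
  note v = left_RL_linear[OF ab alpha(2) this hc h(1), of "variation e" 1 1]
  show "has_continuous_left_RL \<alpha> a b (variation e)"
    and "x \<in> {a..b} \<Longrightarrow> left_RL \<alpha> a b (variation e) x =
      left_RL \<alpha> a b y x + fst e * left_RL \<alpha> a b \<eta>\<^sub>1 x + snd e * left_RL \<alpha> a b \<eta>\<^sub>2 x"
    using v h(2) by (auto simp: variation_def)
qed

lemma right_RL_variation:
  assumes "right_present a b L g"
  shows "has_continuous_right_RL \<beta> a b (variation e)"
    and "x \<in> {a..b} \<Longrightarrow> right_RL \<beta> a b (variation e) x =
      right_RL \<beta> a b y x + fst e * right_RL \<beta> a b \<eta>\<^sub>1 x + snd e * right_RL \<beta> a b \<eta>\<^sub>2 x"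
proof -
  let ?h = "\<lambda>x. fst e * \<eta>\<^sub>1 x + snd e * \<eta>\<^sub>2 x"
  note h = right_RL_linear[OF ab beta(2) test_function_continuous[OF test(1)]
      right_RL_test_function(1)[OF ab beta test(1)] test_function_continuous[OF test(2)]
      right_RL_test_function(1)[OF ab beta test(2)], of ?h "fst e" "snd e", OF refl]
  have hc: "continuous_on {a..b} ?h"
    by (intro continuous_intros test_function_continuous[OF test(1)] test_function_continuous[OF test(2)])
  have "continuous_on {a..b} y" "has_continuous_right_RL \<beta> a b y"
    using y assms by (auto simp: admissible_def)
  note v = right_RL_linear[OF ab beta(2) this hc h(1), of "variation e" 1 1]
  show "has_continuous_right_RL \<beta> a b (variation e)"
    and "x \<in> {a..b} \<Longrightarrow> right_RL \<beta> a b (variation e) x =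
      right_RL \<beta> a b y x + fst e * right_RL \<beta> a b \<eta>\<^sub>1 x + snd e * right_RL \<beta> a b \<eta>\<^sub>2 x"
    using v h(2) by (auto simp: variation_def)
qed

lemma variation_admissible: "variation e \<in> admissible \<alpha> \<beta> a b L g"
proof -
  have "continuous_on {a..b} (variation e)"
    unfolding variation_def[abs_def] using y
    by (intro continuous_intros test_function_continuous[OF test(1)] test_function_continuous[OF test(2)])
      (auto simp: admissible_def)
  then show ?thesis
    using left_RL_variation(1) right_RL_variation(1) by (auto simp: admissible_def)
qed

lemma action_variation:
  assumes F: "F = L \<or> F = g"
  shows "action \<alpha> \<beta> a b F (variation e) =
    integral {a..b} (\<lambda>x. F (x, jet x + fst e *\<^sub>R test_jet \<eta>\<^sub>1 x + snd e *\<^sub>R test_jet \<eta>\<^sub>2 x))"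
  unfolding action_def
proof (rule integral_cong)
  fix x assume x: "x \<in> {a..b}"
  have p: "depends_on_u a b F \<Longrightarrow> left_present a b L g" "depends_on_v a b F \<Longrightarrow> right_present a b L g"
    using F by (auto simp: left_present_def right_present_def)
  show "F (along \<alpha> \<beta> a b (variation e) x) = F (x, jet x + fst e *\<^sub>R test_jet \<eta>\<^sub>1 x + snd e *\<^sub>R test_jet \<eta>\<^sub>2 x)"
    unfolding along_def jet_def test_jet_def scaleR_Pair add_Pair
    \<comment> \<open>On the right-hand side the components are replaced by the true fractional
      derivatives of the varied function. Where a derivative is present, the two agree by linearity;
      where it is absent, they may differ, but \<open>F\<close> does not depend on them.\<close>
    by (subst (2) lagrangian_irrelevant_arguments(1)[OF x,
          where u' = "left_RL \<alpha> a b (variation e) x" and v' = "right_RL \<beta> a b (variation e) x"])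
      (use p x in \<open>simp_all add: left_RL_variation(2) right_RL_variation(2) variation_def add.assoc\<close>)
qed

text \<open>Differentiability at all \<open>e\<close> gives continuity on the whole plane; the
  rewriting by the Euler-Lagrange expression is made at 0 only, where the perturbed curve is
  \<open>jet\<close> and regularity is available.\<close>

lemma action_variation_derivative:
  assumes F: "F = L \<or> F = g" and reg: "regular_along \<alpha> \<beta> a b F y"
  shows "continuous_on UNIV (\<lambda>e. action \<alpha> \<beta> a b F (variation e))"
    and "((\<lambda>e. action \<alpha> \<beta> a b F (variation e)) has_derivative
      (\<lambda>h. fst h * integral {a..b} (\<lambda>x. \<eta>\<^sub>1 x * euler_lagrange \<alpha> \<beta> a b F y x)
         + snd h * integral {a..b} (\<lambda>x. \<eta>\<^sub>2 x * euler_lagrange \<alpha> \<beta> a b F y x))) (at 0)"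
proof -
  have cont: "has_continuous_partials (lag_dom a b) F" using F L g by auto
  note d = action_variation_has_derivative[OF cont continuous_on_jet
      continuous_on_test_jet[OF test(1)] continuous_on_test_jet[OF test(2)], folded action_variation[OF F]]
  show "continuous_on UNIV (\<lambda>e. action \<alpha> \<beta> a b F (variation e))"
    using d by (intro continuous_at_imp_continuous_on ballI has_derivative_continuous)
  show "((\<lambda>e. action \<alpha> \<beta> a b F (variation e)) has_derivative
      (\<lambda>h. fst h * integral {a..b} (\<lambda>x. \<eta>\<^sub>1 x * euler_lagrange \<alpha> \<beta> a b F y x)
         + snd h * integral {a..b} (\<lambda>x. \<eta>\<^sub>2 x * euler_lagrange \<alpha> \<beta> a b F y x))) (at 0)"
    using d[of 0] by (simp add: first_variation[OF F reg test(1)] first_variation[OF F reg test(2)])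
qed

end

end

text \<open>Sussmann's open mapping theorem: a continuous map whose derivative at one point has a
  right inverse sends neighbourhoods of that point to neighbourhoods of its image. The image of
  \<open>T\<close> thus contains a ball, and its horizontal diameter keeps \<psi> fixed while \<phi>
  moves both ways. The set \<open>T\<close> is where smallness in the norm will enter.\<close>

lemma plane_map_covers_horizontal_segment:
  fixes \<phi> \<psi> :: "real \<times> real \<Rightarrow> real"
  assumes cont: "continuous_on UNIV \<phi>" "continuous_on UNIV \<psi>"
    and d\<phi>: "(\<phi> has_derivative (\<lambda>h. fst h * A\<^sub>1 + snd h * A\<^sub>2)) (at 0)"
    and d\<psi>: "(\<psi> has_derivative (\<lambda>h. fst h * B\<^sub>1 + snd h * B\<^sub>2)) (at 0)"
    and det: "A\<^sub>1 * B\<^sub>2 - A\<^sub>2 * B\<^sub>1 \<noteq> 0" and T: "open T" "0 \<in> T"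
  obtains \<epsilon> where "0 < \<epsilon>" "\<And>s. \<bar>s\<bar> < \<epsilon> \<Longrightarrow> \<exists>e\<in>T. \<phi> e = \<phi> 0 + s \<and> \<psi> e = \<psi> 0"
proof -
  define D where "D = A\<^sub>1 * B\<^sub>2 - A\<^sub>2 * B\<^sub>1"
  let ?f = "\<lambda>e. (\<phi> e, \<psi> e)"
  let ?f' = "\<lambda>h. (fst h * A\<^sub>1 + snd h * A\<^sub>2, fst h * B\<^sub>1 + snd h * B\<^sub>2)"
  \<comment> \<open>The inverse of the two-by-two Jacobian by Cramer's rule.\<close>
  let ?g' = "\<lambda>k. ((fst k * B\<^sub>2 - snd k * A\<^sub>2) * (1 / D), (snd k * A\<^sub>1 - fst k * B\<^sub>1) * (1 / D))"
  have D: "D \<noteq> 0" using det by (simp add: D_def)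
  have "?f' (?g' k) = k" for k
  proof -
    have "fst k * (A\<^sub>1 * B\<^sub>2 - A\<^sub>2 * B\<^sub>1) / D = fst k" "snd k * (A\<^sub>1 * B\<^sub>2 - A\<^sub>2 * B\<^sub>1) / D = snd k"
      using D by (simp_all add: D_def)
    then show ?thesis
      by (auto simp: prod_eq_iff field_simps D)
  qed
  then have inv: "?f' \<circ> ?g' = id" by (auto simp: fun_eq_iff)
  have bl: "bounded_linear ?g'"
    by (intro bounded_linear_Pair bounded_linear_mult_const[THEN bounded_linear_compose] bounded_linear_sub
        bounded_linear_fst bounded_linear_snd bounded_linear_compose[OF bounded_linear_mult_left])
  have "?f 0 \<in> interior (?f ` T)"
  proof (rule sussmann_open_mapping[OF open_UNIV _ UNIV_I _ bl inv])
    show "continuous_on UNIV ?f" by (intro continuous_on_Pair cont)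
    show "(?f has_derivative ?f') (at 0)" by (intro has_derivative_Pair d\<phi> d\<psi>)
    show "0 \<in> interior T" using T by (simp add: interior_open)
  qed auto
  then obtain \<epsilon> where \<epsilon>: "0 < \<epsilon>" "ball (?f 0) \<epsilon> \<subseteq> ?f ` T"
    unfolding mem_interior by blast
  show thesis
  proof (rule that[OF \<epsilon>(1)])
    fix s :: real assume "\<bar>s\<bar> < \<epsilon>"
    then have "(\<phi> 0 + s, \<psi> 0) \<in> ball (?f 0) \<epsilon>"
      by (simp add: dist_Pair_Pair dist_real_def)
    then show "\<exists>e\<in>T. \<phi> e = \<phi> 0 + s \<and> \<psi> e = \<psi> 0" using \<epsilon>(2) by fastforce
  qed
qed

section \<open>Lagrange multipliers\<close>

context fractional_problem
begin

text \<open>The multipliers are found for the separate expressions of \<open>L\<close> and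
  \<open>g\<close>. Passing to the expression of the combined Lagrangian requires the fractional
  derivatives of the combination to split, which the regularity of both parts guarantees.\<close>

lemma euler_lagrange_linear:
  assumes regL: "regular_along \<alpha> \<beta> a b L y" and regg: "regular_along \<alpha> \<beta> a b g y" and x: "x \<in> {a..b}"
  shows "euler_lagrange \<alpha> \<beta> a b (\<lambda>z. r * L z - s * g z) y x =
    r * euler_lagrange \<alpha> \<beta> a b L y x - s * euler_lagrange \<alpha> \<beta> a b g y x"
proof -
  let ?K = "\<lambda>z. r * L z - s * g z"
  have z: "along \<alpha> \<beta> a b y t \<in> lag_dom a b" if "t \<in> {a..b}" for t
    using that by (simp add: along_def lag_dom_def)
  note lin = partials_linear[OF L g z]
  have cL: "continuous_on {a..b} (\<lambda>x. partial_u a b L (along \<alpha> \<beta> a b y x))"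
      "continuous_on {a..b} (\<lambda>x. partial_v a b L (along \<alpha> \<beta> a b y x))"
    and cg: "continuous_on {a..b} (\<lambda>x. partial_u a b g (along \<alpha> \<beta> a b y x))"
      "continuous_on {a..b} (\<lambda>x. partial_v a b g (along \<alpha> \<beta> a b y x))"
    using continuous_on_partials_along[of L] continuous_on_partials_along[of g] by auto
  have "right_RL \<alpha> a b (\<lambda>s. partial_u a b ?K (along \<alpha> \<beta> a b y s)) x =
      r * right_RL \<alpha> a b (\<lambda>s. partial_u a b L (along \<alpha> \<beta> a b y s)) x
      + (- s) * right_RL \<alpha> a b (\<lambda>s. partial_u a b g (along \<alpha> \<beta> a b y s)) x"
    using regL regg lin(2)
    by (intro right_RL_linear(2)[OF ab alpha(2) cL(1) _ cg(1)] x) (simp_all add: regular_along_def)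
  moreover have "left_RL \<beta> a b (\<lambda>s. partial_v a b ?K (along \<alpha> \<beta> a b y s)) x =
      r * left_RL \<beta> a b (\<lambda>s. partial_v a b L (along \<alpha> \<beta> a b y s)) x
      + (- s) * left_RL \<beta> a b (\<lambda>s. partial_v a b g (along \<alpha> \<beta> a b y s)) x"
    using regL regg lin(3)
    by (intro left_RL_linear(2)[OF ab beta(2) cL(2) _ cg(2)] x) (simp_all add: regular_along_def)
  ultimately show ?thesis
    using lin(1)[OF x] by (simp add: euler_lagrange_def algebra_simps)
qed

lemma first_variations_dependent:
  assumes regL: "regular_along \<alpha> \<beta> a b L y" and regg: "regular_along \<alpha> \<beta> a b g y"
    and N: "is_norm_on a b (admissible \<alpha> \<beta> a b L g) N"
    and opt: "local_minimizer N (feasible \<alpha> \<beta> a b L g y\<^sub>a y\<^sub>b l) (action \<alpha> \<beta> a b L) y \<or>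
         local_maximizer N (feasible \<alpha> \<beta> a b L g y\<^sub>a y\<^sub>b l) (action \<alpha> \<beta> a b L) y"
    and test: "test_function a b \<eta>\<^sub>1 \<eta>\<^sub>1'" "test_function a b \<eta>\<^sub>2 \<eta>\<^sub>2'"
  defines "\<delta> \<equiv> \<lambda>F \<eta>. integral {a..b} (\<lambda>x. \<eta> x * euler_lagrange \<alpha> \<beta> a b F y x)"
  shows "\<delta> L \<eta>\<^sub>1 * \<delta> g \<eta>\<^sub>2 = \<delta> L \<eta>\<^sub>2 * \<delta> g \<eta>\<^sub>1"
proof (rule ccontr)
  assume "\<delta> L \<eta>\<^sub>1 * \<delta> g \<eta>\<^sub>2 \<noteq> \<delta> L \<eta>\<^sub>2 * \<delta> g \<eta>\<^sub>1"
  then have det: "\<delta> L \<eta>\<^sub>1 * \<delta> g \<eta>\<^sub>2 - \<delta> L \<eta>\<^sub>2 * \<delta> g \<eta>\<^sub>1 \<noteq> 0" by simp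
  let ?X = "feasible \<alpha> \<beta> a b L g y\<^sub>a y\<^sub>b l" and ?J = "action \<alpha> \<beta> a b L"
  let ?y = "variation \<eta>\<^sub>1 \<eta>\<^sub>2"
  obtain d where d: "0 < d" and "y \<in> ?X" and
    opt': "(\<forall>y\<^sub>1\<in>?X. N (\<lambda>x. y x - y\<^sub>1 x) < d \<longrightarrow> ?J y \<le> ?J y\<^sub>1) \<or>
      (\<forall>y\<^sub>1\<in>?X. N (\<lambda>x. y x - y\<^sub>1 x) < d \<longrightarrow> ?J y\<^sub>1 \<le> ?J y)"
    using opt unfolding local_minimizer_def local_maximizer_def by blast
  \<comment> \<open>The bound that the triangle inequality and homogeneity give for the norm of the
    perturbation. It is continuous in \<open>e\<close> for any norm, so \<open>T\<close> is an open
    set of parameters whose variations lie within the radius of the local extremum.\<close>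
  define T where "T = {e. \<bar>fst e\<bar> * N \<eta>\<^sub>1 + \<bar>snd e\<bar> * N \<eta>\<^sub>2 < d}"
  have adm: "\<eta> \<in> admissible \<alpha> \<beta> a b L g" if "test_function a b \<eta> \<eta>'" for \<eta> \<eta>'
    using left_RL_test_function(1)[OF ab alpha that] right_RL_test_function(1)[OF ab beta that]
      test_function_continuous[OF that] by (simp add: admissible_def)
  \<comment> \<open>The norm axioms speak of admissible functions only, so each scaled summand must
    be known to be admissible before the triangle inequality applies.\<close>
  have adm_scale: "(\<lambda>x. c * \<eta> x) \<in> admissible \<alpha> \<beta> a b L g" if t: "test_function a b \<eta> \<eta>'" for c \<eta> \<eta>'
  proof -
    have "has_continuous_left_RL \<alpha> a b (\<lambda>x. c * \<eta> x)"
      by (rule left_RL_linear(1)[OF ab alpha(2) test_function_continuous[OF t] left_RL_test_function(1)[OF ab alpha t]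
         test_function_continuous[OF t] left_RL_test_function(1)[OF ab alpha t], of _ c 0]) simp
    moreover have "has_continuous_right_RL \<beta> a b (\<lambda>x. c * \<eta> x)"
      by (rule right_RL_linear(1)[OF ab beta(2) test_function_continuous[OF t] right_RL_test_function(1)[OF ab beta t]
         test_function_continuous[OF t] right_RL_test_function(1)[OF ab beta t], of _ c 0]) simp
    ultimately show ?thesis
      using test_function_continuous[OF t] by (auto simp: admissible_def intro!: continuous_intros)
  qed
  have triangle: "N (\<lambda>x. f x + h x) \<le> N f + N h"
    if "f \<in> admissible \<alpha> \<beta> a b L g" "h \<in> admissible \<alpha> \<beta> a b L g" for f h
    using N that unfolding is_norm_on_def by blast
  have scale: "N (\<lambda>x. c * f x) = \<bar>c\<bar> * N f" if "f \<in> admissible \<alpha> \<beta> a b L g" for f c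
    using N that unfolding is_norm_on_def by blast
  have near: "N (\<lambda>x. y x - ?y e x) < d" if "e \<in> T" for e
  proof -
    have "N (\<lambda>x. (- fst e) * \<eta>\<^sub>1 x + (- snd e) * \<eta>\<^sub>2 x) \<le> N (\<lambda>x. (- fst e) * \<eta>\<^sub>1 x) + N (\<lambda>x. (- snd e) * \<eta>\<^sub>2 x)"
      by (rule triangle[OF adm_scale[OF test(1)] adm_scale[OF test(2)]])
    also have "\<dots> = \<bar>- fst e\<bar> * N \<eta>\<^sub>1 + \<bar>- snd e\<bar> * N \<eta>\<^sub>2"
      by (simp only: scale[OF adm[OF test(1)]] scale[OF adm[OF test(2)]])
    finally show ?thesis
      using that by (simp add: T_def variation_def[OF test] algebra_simps)
  qed
  have endpoints: "\<eta> a = 0 \<and> \<eta> b = 0" if "test_function a b \<eta> \<eta>'" for \<eta> \<eta>'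
    using that unfolding test_function_def by fastforce
  have bd: "?y e a = y a" "?y e b = y b" for e
    using endpoints[OF test(1)] endpoints[OF test(2)] by (simp_all add: variation_def[OF test])
  have y0: "?y 0 = y" by (simp add: variation_def[OF test] fun_eq_iff)
  have T: "open T" "0 \<in> T"
    using d unfolding T_def by (auto intro!: open_Collect_less continuous_intros)
  note dL = action_variation_derivative[OF test disjI1[OF refl] regL]
  note dg = action_variation_derivative[OF test disjI2[OF refl] regg]
  obtain \<epsilon> where \<epsilon>: "0 < \<epsilon>"
    "\<And>s. \<bar>s\<bar> < \<epsilon> \<Longrightarrow> \<exists>e\<in>T. ?J (?y e) = ?J y + s \<and> action \<alpha> \<beta> a b g (?y e) = action \<alpha> \<beta> a b g y"
    using plane_map_covers_horizontal_segment[OF dL(1) dg(1) dL(2) dg(2) det[unfolded \<delta>_def] T] unfolding y0 by metis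
  have reach: "\<exists>y\<^sub>1\<in>?X. N (\<lambda>x. y x - y\<^sub>1 x) < d \<and> ?J y\<^sub>1 = ?J y + s" if s: "\<bar>s\<bar> < \<epsilon>" for s
  proof -
    obtain e where "e \<in> T" "?J (?y e) = ?J y + s" "action \<alpha> \<beta> a b g (?y e) = action \<alpha> \<beta> a b g y"
      using \<epsilon>(2)[OF s] by blast
    moreover have "?y e \<in> ?X"
      using \<open>y \<in> ?X\<close> variation_admissible[OF test] bd calculation(3) by (simp add: feasible_def)
    ultimately show ?thesis using near by blast
  qed
  \<comment> \<open>One competitor raises the objective and the other lowers it by the same amount,
    so minimizers and maximizers are refuted together.\<close>
  obtain y\<^sub>1 y\<^sub>2 where "y\<^sub>1 \<in> ?X" "N (\<lambda>x. y x - y\<^sub>1 x) < d" "?J y\<^sub>1 = ?J y + \<epsilon> / 2"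
    and "y\<^sub>2 \<in> ?X" "N (\<lambda>x. y x - y\<^sub>2 x) < d" "?J y\<^sub>2 = ?J y + - (\<epsilon> / 2)"
    using reach[of "\<epsilon> / 2"] reach[of "- (\<epsilon> / 2)"] \<epsilon>(1) by auto
  then show False
    using opt' \<epsilon>(1) by fastforce
qed

text \<open>Two linear functionals whose two-by-two minors all vanish are linearly dependent. The
  resulting combination of first variations is zero on every test function, and the fundamental
  lemma turns this into a pointwise identity.\<close>

lemma multiplier_rule:
  assumes regL: "regular_along \<alpha> \<beta> a b L y" and regg: "regular_along \<alpha> \<beta> a b g y"
  defines "\<delta> \<equiv> \<lambda>F \<eta>. integral {a..b} (\<lambda>x. \<eta> x * euler_lagrange \<alpha> \<beta> a b F y x)"
  assumes dep: "\<And>\<eta>\<^sub>1 \<eta>\<^sub>1' \<eta>\<^sub>2 \<eta>\<^sub>2'. test_function a b \<eta>\<^sub>1 \<eta>\<^sub>1' \<Longrightarrow> test_function a b \<eta>\<^sub>2 \<eta>\<^sub>2' \<Longrightarrow>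
    \<delta> L \<eta>\<^sub>1 * \<delta> g \<eta>\<^sub>2 = \<delta> L \<eta>\<^sub>2 * \<delta> g \<eta>\<^sub>1"
  obtains r s where "\<not> (r = 0 \<and> s = 0)"
    "\<And>x. x \<in> {a..b} \<Longrightarrow> euler_lagrange \<alpha> \<beta> a b (\<lambda>z. r * L z - s * g z) y x = 0"
proof -
  let ?E = "\<lambda>F. euler_lagrange \<alpha> \<beta> a b F y"
  have cL: "continuous_on {a..b} (?E L)" and cg: "continuous_on {a..b} (?E g)"
    using continuous_on_euler_lagrange regL regg by auto
  obtain r s where rs: "\<not> (r = 0 \<and> s = 0)"
    and zero: "\<And>\<eta> \<eta>'. test_function a b \<eta> \<eta>' \<Longrightarrow> r * \<delta> L \<eta> - s * \<delta> g \<eta> = 0"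
  proof (cases "\<forall>\<eta> \<eta>'. test_function a b \<eta> \<eta>' \<longrightarrow> \<delta> g \<eta> = 0")
    \<comment> \<open>The abnormal case: the first variation of the constraint vanishes identically,
      so \<open>g\<close> alone satisfies the equation and \<open>L\<close> receives the multiplier
      0.\<close>
    case True
    then show ?thesis using that[of 0 1] by auto
  next
    case False
    then obtain \<eta>\<^sub>2 \<eta>\<^sub>2' where \<eta>\<^sub>2: "test_function a b \<eta>\<^sub>2 \<eta>\<^sub>2'" "\<delta> g \<eta>\<^sub>2 \<noteq> 0" by blast
    show ?thesis
    \<comment> \<open>With \<open>\<eta>\<^sub>2\<close> fixed, the vanishing minor is a linear
      relation in the other test function, and its coefficients are the multipliers. They are
      nontrivial because the first is nonzero by the choice of
      \<open>\<eta>\<^sub>2\<close>.\<close>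
    proof (rule that[of "\<delta> g \<eta>\<^sub>2" "\<delta> L \<eta>\<^sub>2"])
      show "\<delta> g \<eta>\<^sub>2 * \<delta> L \<eta> - \<delta> L \<eta>\<^sub>2 * \<delta> g \<eta> = 0" if "test_function a b \<eta> \<eta>'" for \<eta> \<eta>'
        using dep[OF that \<eta>\<^sub>2(1)] by (simp add: mult.commute)
    qed (use \<eta>\<^sub>2 in simp)
  qed
  have "r * ?E L x - s * ?E g x = 0" if x: "x \<in> {a..b}" for x
  proof (rule fundamental_lemma_variations[OF ab _ _ x])
    show "continuous_on {a..b} (\<lambda>x. r * ?E L x - s * ?E g x)"
      by (intro continuous_intros cL cg)
    fix \<eta> \<eta>' assume t: "test_function a b \<eta> \<eta>'"
    have "(\<lambda>x. \<eta> x * ?E L x) integrable_on {a..b}" "(\<lambda>x. \<eta> x * ?E g x) integrable_on {a..b}"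
      by (intro integrable_continuous_real continuous_on_mult test_function_continuous[OF t] cL cg)+
    then have "((\<lambda>x. r * (\<eta> x * ?E L x) - s * (\<eta> x * ?E g x)) has_integral r * \<delta> L \<eta> - s * \<delta> g \<eta>) {a..b}"
      unfolding \<delta>_def by (intro has_integral_diff has_integral_mult_right integrable_integral)
    then show "integral {a..b} (\<lambda>x. \<eta> x * (r * ?E L x - s * ?E g x)) = 0"
      unfolding zero[OF t] by (intro integral_unique) (simp add: algebra_simps)
  qed
  then show thesis
    using that[OF rs] euler_lagrange_linear[OF regL regg] by simp
qed

end

theorem theorem7:
  fixes a b \<alpha> \<beta> l y\<^sub>a y\<^sub>b :: real
    and L g :: "real \<times> real \<times> real \<times> real \<Rightarrow> real"
    and N :: "(real \<Rightarrow> real) \<Rightarrow> real"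
    and y :: "real \<Rightarrow> real"
  assumes "a < b"
    and "0 < \<alpha>" "\<alpha> < 1" "0 < \<beta>" "\<beta> < 1"
    and "has_continuous_partials2 (lag_dom a b) L"
    and "has_continuous_partials2 (lag_dom a b) g"
    and "left_present a b L g \<Longrightarrow> y\<^sub>a = 0"
    and "right_present a b L g \<Longrightarrow> y\<^sub>b = 0"
    and "is_norm_on a b (admissible \<alpha> \<beta> a b L g) N"
    and "local_minimizer N (feasible \<alpha> \<beta> a b L g y\<^sub>a y\<^sub>b l) (action \<alpha> \<beta> a b L) y \<or>
         local_maximizer N (feasible \<alpha> \<beta> a b L g y\<^sub>a y\<^sub>b l) (action \<alpha> \<beta> a b L) y"
    and "regular_along \<alpha> \<beta> a b L y"
    and "regular_along \<alpha> \<beta> a b g y"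
  shows "\<exists>lam0 lam :: real. \<not> (lam0 = 0 \<and> lam = 0) \<and>
           (let K = (\<lambda>z. lam0 * L z - lam * g z) in
            \<forall>x\<in>{a..b}.
              partial_y a b K (along \<alpha> \<beta> a b y x)
              + right_RL \<alpha> a b (\<lambda>s. partial_u a b K (along \<alpha> \<beta> a b y s)) x
              + left_RL \<beta> a b (\<lambda>s. partial_v a b K (along \<alpha> \<beta> a b y s)) x = 0)"
proof -
  interpret fractional_problem \<alpha> \<beta> a b L g y
    using assms(1-7,11) unfolding has_continuous_partials2_def
    by unfold_locales (auto simp: local_minimizer_def local_maximizer_def feasible_def)
  show ?thesis
  proof (rule multiplier_rule[OF assms(12,13) first_variations_dependent[OF assms(12,13,10,11)]])
    fix r s :: real
    assume "\<not> (r = 0 \<and> s = 0)"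
      and "\<And>x. x \<in> {a..b} \<Longrightarrow> euler_lagrange \<alpha> \<beta> a b (\<lambda>z. r * L z - s * g z) y x = 0"
    then show ?thesis
      unfolding euler_lagrange_def Let_def by (intro exI[of _ r] exI[of _ s] conjI ballI)
  qed
qed

end
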